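(* Let $k\ge 1$ be an integer, let $G=(V,E)$ be a finite $(k+1)$-claw free graph with positive vertex weights $w_v$, and let $O$ be an independent set of $G$ of maximum total weight. Run the Squared Weight Local Search with $s$-Exchanges (described in the context) and let $S$ be the set it returns. (i) If $s=k(k-1)+1$, then $w(O)\le \frac{k+1-\tau_k}{2}\,w(S)$, where $$\tau_k=\max_{\epsilon\in[0,1/2]}\min\left\{\frac{1-\epsilon}{2-\epsilon},\ \Big(k-\frac{1}{\sqrt{1-\epsilon}}\Big)\big(1-\sqrt{1-\epsilon}\big)\right\};$$ moreover $\tau_k$ is non-decreasing in $k$ and $\lim_{k\to\infty}\tau_k=1/2$. (ii) If $s=2k(k-1)+1$, then $w(O)\le \frac{k+1-\tau_k}{2}\,w(S)$, where $$\tau_k=\max_{\epsilon\in[0,1/2]}\min\left\{\frac{2(1-\epsilon)}{3-\epsilon},\ \Big(k-\frac{1}{\sqrt{1-\epsilon}}\Big)\big(1-\sqrt{1-\epsilon}\big),\ 2-\frac{1}{\sqrt{1-\epsilon}}\right\};$$ moreover $\tau_k$ is non-decreasing in $k$ and $\lim_{k\to\infty}\tau_k=2/3$.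
   Context: A $d$-claw in a graph is an induced subgraph consisting of one vertex (the center) adjacent to $d$ pairwise non-adjacent vertices (the talons); a graph is $(k+1)$-claw free if it contains no $(k+1)$-claw. (Weighted $k$-set packing, where one seeks a maximum-weight family of pairwise disjoint sets among given weighted sets of size at most $k$, is the special case where $G$ is the conflict graph having one vertex per set and an edge between any two intersecting sets.) For $X\subseteq V$, $w(X)=\sum_{v\in X}w_v$ and $w^2(X)=\sum_{v\in X}w_v^2$. For $X,Y\subseteq V$, $N(X,Y)=\{y\in Y: y \text{ is adjacent to some } x\in X\}\cup(X\cap Y)$. The algorithm (with integer parameter $s\ge1$): initialize $S$ as the output of the standard greedy algorithm for maximum weight independent set on $(G,w)$; then repeatedly, as long as there is an independent set $C\subseteq V\setminus S$ with at most $sk$ vertices such that $w^2(C)>w^2(N(C,S))$, replace $S$ by $(S\cup C)\setminus N(C,S)$; when no such $C$ exists, return $S$. *)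

theory Defs
  imports Complex_Main "Graph_Theory.Digraph"
begin

text \<open>
  Finite simple graphs are finite symmetric digraphs without loops or multiple arcs, as in the
  locale \<^locale>\<open>graph\<close>; adjacency of \<open>u\<close> and \<open>v\<close> is \<open>u \<rightarrow>\<^bsub>G\<^esub> v\<close>.
\<close>

definition independent :: "('a, 'b) pre_digraph \<Rightarrow> 'a set \<Rightarrow> bool" where
  "independent G X \<longleftrightarrow> X \<subseteq> verts G \<and> (\<forall>u\<in>X. \<forall>v\<in>X. \<not> u \<rightarrow>\<^bsub>G\<^esub> v)"

text \<open>
  A claw is given by its center \<open>c\<close> and its set \<open>T\<close> of talons; these adjacencies determine the
  subgraph induced on \<open>insert c T\<close>.
\<close>

definition is_claw :: "('a, 'b) pre_digraph \<Rightarrow> nat \<Rightarrow> 'a \<Rightarrow> 'a set \<Rightarrow> bool" where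
  "is_claw G d c T \<longleftrightarrow>
     c \<in> verts G \<and> independent G T \<and> card T = d \<and> (\<forall>t\<in>T. c \<rightarrow>\<^bsub>G\<^esub> t)"

definition claw_free :: "('a, 'b) pre_digraph \<Rightarrow> nat \<Rightarrow> bool" where
  "claw_free G d \<longleftrightarrow> (\<nexists>c T. is_claw G d c T)"

definition weight :: "('a \<Rightarrow> real) \<Rightarrow> 'a set \<Rightarrow> real" where
  "weight w X = (\<Sum>v\<in>X. w v)"

definition sq_weight :: "('a \<Rightarrow> real) \<Rightarrow> 'a set \<Rightarrow> real" where
  "sq_weight w X = (\<Sum>v\<in>X. (w v)\<^sup>2)"

definition max_weight_independent :: "('a, 'b) pre_digraph \<Rightarrow> ('a \<Rightarrow> real) \<Rightarrow> 'a set \<Rightarrow> bool" where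
  "max_weight_independent G w X \<longleftrightarrow>
     independent G X \<and> (\<forall>Y. independent G Y \<longrightarrow> weight w Y \<le> weight w X)"

definition nbhd :: "('a, 'b) pre_digraph \<Rightarrow> 'a set \<Rightarrow> 'a set \<Rightarrow> 'a set" where
  "nbhd G X Y = {y \<in> Y. \<exists>x\<in>X. x \<rightarrow>\<^bsub>G\<^esub> y} \<union> (X \<inter> Y)"

text \<open>
  The algorithms leave choices open (ties in the greedy phase, the exchanged set \<open>C\<close> in the local
  search), so each is a step relation, and an output is any state reachable from the initial
  state in which no step is possible.
\<close>

definition runs_to :: "('s \<Rightarrow> 's \<Rightarrow> bool) \<Rightarrow> 's \<Rightarrow> 's \<Rightarrow> bool" where
  "runs_to step x y \<longleftrightarrow> step\<^sup>*\<^sup>* x y \<and> (\<nexists>z. step y z)"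

text \<open>The vertices that the greedy algorithm may still add to the current set \<open>S\<close>.\<close>

definition greedy_candidates :: "('a, 'b) pre_digraph \<Rightarrow> 'a set \<Rightarrow> 'a set" where
  "greedy_candidates G S = {v \<in> verts G - S. \<forall>u\<in>S. \<not> u \<rightarrow>\<^bsub>G\<^esub> v}"

inductive greedy_step ::
    "('a, 'b) pre_digraph \<Rightarrow> ('a \<Rightarrow> real) \<Rightarrow> 'a set \<Rightarrow> 'a set \<Rightarrow> bool" for G w where
  "\<lbrakk>v \<in> greedy_candidates G S; \<forall>u\<in>greedy_candidates G S. w u \<le> w v\<rbrakk>
   \<Longrightarrow> greedy_step G w S (insert v S)"

inductive exchange_step ::
    "nat \<Rightarrow> nat \<Rightarrow> ('a, 'b) pre_digraph \<Rightarrow> ('a \<Rightarrow> real) \<Rightarrow> 'a set \<Rightarrow> 'a set \<Rightarrow> bool"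
  for s k G w where
  "\<lbrakk>C \<subseteq> verts G - S; independent G C; card C \<le> s * k;
    sq_weight w C > sq_weight w (nbhd G C S)\<rbrakk>
   \<Longrightarrow> exchange_step s k G w S ((S \<union> C) - nbhd G C S)"

definition local_search_returns ::
    "nat \<Rightarrow> nat \<Rightarrow> ('a, 'b) pre_digraph \<Rightarrow> ('a \<Rightarrow> real) \<Rightarrow> 'a set \<Rightarrow> bool" where
  "local_search_returns s k G w S \<longleftrightarrow>
     (\<exists>S\<^sub>0. runs_to (greedy_step G w) {} S\<^sub>0 \<and> runs_to (exchange_step s k G w) S\<^sub>0 S)"

definition tau1_objective :: "nat \<Rightarrow> real \<Rightarrow> real" where
  "tau1_objective k \<epsilon> =
     min ((1 - \<epsilon>) / (2 - \<epsilon>)) ((real k - 1 / sqrt (1 - \<epsilon>)) * (1 - sqrt (1 - \<epsilon>)))"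

definition tau2_objective :: "nat \<Rightarrow> real \<Rightarrow> real" where
  "tau2_objective k \<epsilon> =
     min (2 * (1 - \<epsilon>) / (3 - \<epsilon>))
       (min ((real k - 1 / sqrt (1 - \<epsilon>)) * (1 - sqrt (1 - \<epsilon>))) (2 - 1 / sqrt (1 - \<epsilon>)))"

text \<open>\<^const>\<open>Max\<close> is meaningful for finite sets only, so maxima are taken with \<^const>\<open>Greatest\<close>.\<close>

definition tau1 :: "nat \<Rightarrow> real" where
  "tau1 k = (GREATEST t. t \<in> tau1_objective k ` {0..1/2})"

definition tau2 :: "nat \<Rightarrow> real" where
  "tau2 k = (GREATEST t. t \<in> tau2_objective k ` {0..1/2})"

text \<open>Both maxima are attained, and every run of the algorithm ends with an output.\<close>

lemma Greatest_image_is_max: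
  fixes f :: "real \<Rightarrow> real"
  assumes "continuous_on {0..1/2} f"
  shows "(GREATEST t. t \<in> f ` {0..1/2}) \<in> f ` {0..1/2}"
    and "e \<in> {0..1/2} \<Longrightarrow> f e \<le> (GREATEST t. t \<in> f ` {0..1/2})"
proof -
  obtain x where x: "x \<in> {0..1/2}" "\<forall>y\<in>{0..1/2}. f y \<le> f x"
    using continuous_attains_sup[of "{0..1/2}" f] assms by auto
  then have eq: "(GREATEST t. t \<in> f ` {0..1/2}) = f x"
    by (intro Greatest_equality) auto
  show "(GREATEST t. t \<in> f ` {0..1/2}) \<in> f ` {0..1/2}" using x eq by simp
  show "f e \<le> (GREATEST t. t \<in> f ` {0..1/2})" if "e \<in> {0..1/2}" using that x eq by simp
qed

lemma continuous_on_tau1_objective: "continuous_on {0..1/2} (tau1_objective k)"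
  unfolding tau1_objective_def by (intro continuous_intros) auto

lemma continuous_on_tau2_objective: "continuous_on {0..1/2} (tau2_objective k)"
  unfolding tau2_objective_def by (intro continuous_intros) auto

lemma tau1_attained: "tau1 k \<in> tau1_objective k ` {0..1/2}"
  and tau1_upper: "e \<in> {0..1/2} \<Longrightarrow> tau1_objective k e \<le> tau1 k"
  unfolding tau1_def by (simp_all only: Greatest_image_is_max[OF continuous_on_tau1_objective])

lemma tau2_attained: "tau2 k \<in> tau2_objective k ` {0..1/2}"
  and tau2_upper: "e \<in> {0..1/2} \<Longrightarrow> tau2_objective k e \<le> tau2 k"
  unfolding tau2_def by (simp_all only: Greatest_image_is_max[OF continuous_on_tau2_objective])

text \<open>A step relation on subsets of a finite set that increases a real potential terminates.\<close>

lemma wf_increasing_on_Pow: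
  fixes p :: "'a set \<Rightarrow> real"
  assumes "finite V"
    and "\<And>S T. S \<subseteq> V \<Longrightarrow> step S T \<Longrightarrow> T \<subseteq> V \<and> p S < p T"
  shows "wf {(T, S). S \<subseteq> V \<and> step S T}"
proof (rule finite_acyclic_wf)
  have "{(T, S). S \<subseteq> V \<and> step S T} \<subseteq> Pow V \<times> Pow V" using assms(2) by auto
  then show "finite {(T, S). S \<subseteq> V \<and> step S T}"
    by (rule finite_subset) (use assms(1) in simp)
  have "p S < p T" if "(T, S) \<in> {(T, S). S \<subseteq> V \<and> step S T}\<^sup>+" for S T
    using that
  proof (induction rule: trancl.induct)
    case (r_into_trancl T S)
    then show ?case using assms(2) by simp
  next
    case (trancl_into_trancl T U S)
    then have "p S < p U" using assms(2) by simp
    then show ?case using trancl_into_trancl.IH by (rule less_trans)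
  qed
  then show "acyclic {(T, S). S \<subseteq> V \<and> step S T}"
    unfolding acyclic_def by (meson less_irrefl)
qed

lemma runs_to_exists:
  assumes wf: "wf {(T, S). S \<subseteq> V \<and> step S T}"
    and closed: "\<And>S T. S \<subseteq> V \<Longrightarrow> step S T \<Longrightarrow> T \<subseteq> V"
    and "S \<subseteq> V"
  shows "\<exists>T\<subseteq>V. runs_to step S T"
  using wf \<open>S \<subseteq> V\<close>
proof (induction S rule: wf_induct_rule)
  case (less S)
  show ?case
  proof (cases "\<exists>T. step S T")
    case True
    then obtain T where T: "step S T" by blast
    have "T \<subseteq> V" by (rule closed[OF less.prems T])
    with less.IH[of T] less.prems T obtain U where U: "U \<subseteq> V" "runs_to step T U" by auto
    from U(2) have "runs_to step S U"
      using converse_rtranclp_into_rtranclp[of step, OF T] unfolding runs_to_def by simp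
    with U(1) show ?thesis by auto
  next
    case False
    then have "runs_to step S S" unfolding runs_to_def by simp
    with less.prems show ?thesis by auto
  qed
qed

context
  fixes G :: "('a, 'b) pre_digraph" and w :: "'a \<Rightarrow> real"
  assumes G: "graph G"
begin

lemma finite_vertices: "finite (verts G)"
  using G unfolding graph_def digraph_def by (simp add: fin_digraph.finite_verts)

lemma greedy_step_props:
  assumes "S \<subseteq> verts G" "greedy_step G w S T"
  shows "T \<subseteq> verts G" "card S < card T"
proof -
  from assms(2) obtain v where v: "v \<in> verts G - S" "T = insert v S"
    by cases (auto simp: greedy_candidates_def)
  show "T \<subseteq> verts G" using assms(1) v by simp
  show "card S < card T"
    using v finite_subset[OF assms(1) finite_vertices] by simp
qed

lemma exchange_step_props:
  assumes "S \<subseteq> verts G" "exchange_step s k G w S T"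
  shows "T \<subseteq> verts G" "sq_weight w S < sq_weight w T"
proof -
  from assms(2) obtain C where C: "C \<subseteq> verts G - S"
      "sq_weight w C > sq_weight w (nbhd G C S)" "T = (S \<union> C) - nbhd G C S"
    by cases
  show "T \<subseteq> verts G" using assms(1) C by auto
  have fin: "finite S" "finite C"
    using assms(1) C finite_subset[OF _ finite_vertices] by blast+
  have sub: "nbhd G C S \<subseteq> S" unfolding nbhd_def by auto
  then have "sq_weight w T = sq_weight w (S \<union> C) - sq_weight w (nbhd G C S)"
    unfolding sq_weight_def C(3) using fin by (intro sum_diff) auto
  also have "sq_weight w (S \<union> C) = sq_weight w S + sq_weight w C"
    unfolding sq_weight_def using fin C(1) by (intro sum.union_disjoint) auto
  finally show "sq_weight w S < sq_weight w T" using C(2) by simp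
qed

lemma wf_greedy_step: "wf {(T, S). S \<subseteq> verts G \<and> greedy_step G w S T}"
proof (rule wf_increasing_on_Pow[where p = "\<lambda>S. real (card S)", OF finite_vertices])
  fix S T assume "S \<subseteq> verts G" "greedy_step G w S T"
  from greedy_step_props[OF this]
  show "T \<subseteq> verts G \<and> real (card S) < real (card T)" by simp
qed

lemma wf_exchange_step: "wf {(T, S). S \<subseteq> verts G \<and> exchange_step s k G w S T}"
proof (rule wf_increasing_on_Pow[where p = "sq_weight w", OF finite_vertices])
  fix S T assume "S \<subseteq> verts G" "exchange_step s k G w S T"
  from exchange_step_props[OF this]
  show "T \<subseteq> verts G \<and> sq_weight w S < sq_weight w T" by simp
qed

lemma local_search_returns_exists: "\<exists>S. local_search_returns s k G w S"
proof -
  have "\<exists>T\<subseteq>verts G. runs_to (greedy_step G w) {} T"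
    by (rule runs_to_exists[OF wf_greedy_step]) (rule greedy_step_props(1), assumption+, simp)
  then obtain S\<^sub>0 where S\<^sub>0: "S\<^sub>0 \<subseteq> verts G" "runs_to (greedy_step G w) {} S\<^sub>0"
    by auto
  have "\<exists>T\<subseteq>verts G. runs_to (exchange_step s k G w) S\<^sub>0 T"
    by (rule runs_to_exists[OF wf_exchange_step])
      (rule exchange_step_props(1), assumption+, rule S\<^sub>0(1))
  with S\<^sub>0(2) show ?thesis unfolding local_search_returns_def by auto
qed

end

end

theory Submission
  imports Defs
begin

text \<open>
  Let S be locally optimal, Q independent, and let the apex of q in Q be its heaviest neighbour
  in S. Fix 0 < r <= 1 and x = r^2; a neighbour b of q is heavy if w b >= x * w (apex q), and
  otherwise light. Exchanging all q with apex in a set U gives, for every U with at most s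
  elements, an inequality between the squared weight of U and those of the q. If the weight of q is
  distributed by paying to each heavy neighbour b the amount w b / 2, to each light one r * w b / 2,
  and the remainder to the apex, then a vertex b gets at most (k + 1)/2 times its weight.
  The exchange inequalities of the subsets of U that are closed under passing to lighter vertices
  add up, by Abel summation, to a lower bound for the total amount that the vertices of U miss:
  it is at least half of the sum of min (w a) (w b) over the edges inside U of the graph that
  joins each apex to the other heavy neighbours. As this graph has degree at most k(k-1), its
  components split into connected pieces with at least m + 1 and at most m k(k-1) + 1
  elements. With m = 1 every vertex of a piece lies on an edge, which gives x/(1+x); with m = 2
  every vertex has degree 2 or a neighbour of degree 2, which gives 2x/(2+x).
  In components that are too small all neighbours may be paid at the rate r/2, and then the
  inequality w^2 >= 2 r a w - r^2 a^2 yields the term (k - 1/r)(1 - r).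
\<close>

subsection \<open>Linked sets\<close>

definition linked :: "('a \<times> 'a) set \<Rightarrow> 'a set \<Rightarrow> bool" where
  "linked E W \<longleftrightarrow> (\<forall>u\<in>W. \<forall>v\<in>W. (u, v) \<in> (E \<inter> W \<times> W)\<^sup>*)"

lemma linkedI:
  assumes "sym E" "\<And>v. v \<in> W \<Longrightarrow> (c, v) \<in> (E \<inter> W \<times> W)\<^sup>*"
  shows "linked E W"
proof -
  have "sym (E \<inter> W \<times> W)" using assms(1) by (auto simp: sym_def)
  then have "sym ((E \<inter> W \<times> W)\<^sup>*)" by (rule sym_rtrancl)
  then show ?thesis unfolding linked_def using assms(2) by (metis rtrancl_trans symD)
qed

lemma rtrancl_restrict_mono:
  "(u, v) \<in> (E \<inter> X \<times> X)\<^sup>* \<Longrightarrow> X \<subseteq> Y \<Longrightarrow> (u, v) \<in> (E \<inter> Y \<times> Y)\<^sup>*"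
  by (erule rtrancl_mono[THEN subsetD, rotated]) auto

text \<open>A path from \<open>u\<close> to \<open>v\<close> inside \<open>W\<close> has a first
  step that leaves \<open>X\<close>.\<close>

lemma linked_crossing:
  assumes "linked E W" "X \<subseteq> W" "u \<in> X" "v \<in> W - X"
  shows "\<exists>a\<in>X. \<exists>b\<in>W - X. (a, b) \<in> E"
proof -
  have "(u, v) \<in> (E \<inter> W \<times> W)\<^sup>*" using assms unfolding linked_def by auto
  then have "v \<in> X \<or> ?thesis"
    by (induction rule: rtrancl_induct) (use assms(3) in auto)
  with assms(4) show ?thesis by auto
qed

section \<open>Components of a relation restricted to a set\<close>

definition component :: "('a \<times> 'a) set \<Rightarrow> 'a set \<Rightarrow> 'a \<Rightarrow> 'a set" where
  "component E X u = {v. (u, v) \<in> (E \<inter> X \<times> X)\<^sup>*}"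

lemma component_subset: "u \<in> X \<Longrightarrow> component E X u \<subseteq> X"
  unfolding component_def by (auto elim!: rtrancl_induct)

lemma component_self: "u \<in> component E X u"
  unfolding component_def by simp

lemma component_path:
  assumes "v \<in> component E X u"
  shows "(u, v) \<in> (E \<inter> component E X u \<times> component E X u)\<^sup>*"
proof -
  have "(u, v) \<in> (E \<inter> X \<times> X)\<^sup>*" using assms unfolding component_def by simp
  then show ?thesis
  proof (induction rule: rtrancl_induct)
    case (step y z)
    have "y \<in> component E X u" "z \<in> component E X u"
      using step.hyps unfolding component_def by (auto intro: rtrancl_into_rtrancl)
    with step show ?case by (auto intro: rtrancl_into_rtrancl)
  qed simp
qed

lemma linked_component: "sym E \<Longrightarrow> linked E (component E X u)"
  by (rule linkedI[where c = u]) (auto intro: component_path)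

lemma component_closed:
  assumes "v \<in> component E X u" "(v, z) \<in> E" "v \<in> X" "z \<in> X"
  shows "z \<in> component E X u"
  using assms unfolding component_def by (auto intro: rtrancl_into_rtrancl)

lemma component_disjoint:
  assumes "sym E" "v \<in> component E X u" "v \<in> component E X u'"
  shows "component E X u = component E X u'"
proof -
  have "sym (E \<inter> X \<times> X)" using assms(1) by (auto simp: sym_def)
  then have "sym ((E \<inter> X \<times> X)\<^sup>*)" by (rule sym_rtrancl)
  with assms(2,3) show ?thesis unfolding component_def by (auto, (meson rtrancl_trans symD)+)
qed

text \<open>
  Among the linked sets X with linked complement and more than m elements take a smallest one.
  Deleting from X a vertex on its border leaves only components with at most m elements.
\<close>

lemma linked_split:
  assumes E: "sym E" and fin: "finite W" and W: "linked E W"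
    and deg: "\<And>v. v \<in> W \<Longrightarrow> card {u \<in> W. (v, u) \<in> E} \<le> d"
    and big: "m * d + 1 < card W"
  obtains X Y where "X \<union> Y = W" "X \<inter> Y = {}" "linked E X" "linked E Y"
    "m < card X" "m < card Y"
proof -
  define good where "good X \<longleftrightarrow> X \<subseteq> W \<and> linked E X \<and> linked E (W - X) \<and> m < card X" for X
  \<comment> \<open>For \<open>d = 0\<close> no edge could join the at least two vertices of
    \<open>W\<close>. The bound \<open>1 \<le> d\<close> then gives \<open>m < card W\<close>, so
    that \<open>W\<close> itself is a candidate.\<close>
  have "d = 0 \<Longrightarrow> False"
  proof -
    assume "d = 0"
    have "2 \<le> card W" using big by simp
    then obtain u v where uv: "u \<in> W" "v \<in> W" "u \<noteq> v"
      by (metis card_2_iff' card_le_Suc0_iff_eq fin not_less_eq_eq numeral_2_eq_2)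
    then obtain b where "b \<in> W" "(u, b) \<in> E"
      using linked_crossing[OF W, of "{u}" u v] by auto
    then have "{b' \<in> W. (u, b') \<in> E} \<noteq> {}" by auto
    then have "0 < card {b' \<in> W. (u, b') \<in> E}" using fin by (simp add: card_gt_0_iff)
    with deg[OF uv(1)] \<open>d = 0\<close> show False by simp
  qed
  then have d: "1 \<le> d" by (cases d) auto
  have "m < card W" using big mult_le_mono2[OF d, of m] unfolding mult.right_neutral by linarith
  then have "good W" using W unfolding good_def linked_def by auto
  then obtain X where X: "good X" and least: "\<And>Z. good Z \<Longrightarrow> card X \<le> card Z"
    using ex_has_least_nat[of good W card] by blast
  define Y where "Y = W - X"
  have sub: "X \<subseteq> W" and lX: "linked E X" and lY: "linked E Y" and mX: "m < card X"
    using X unfolding good_def Y_def by auto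
  have finX: "finite X" using sub fin finite_subset by auto
  \<comment> \<open>\<open>v\<close> lies on the border towards \<open>Y\<close>; if
    \<open>Y\<close> is empty, any vertex of \<open>X\<close> serves.\<close>
  obtain v where v: "v \<in> X" and vY: "Y = {} \<or> (\<exists>y\<in>Y. (v, y) \<in> E)"
  proof (cases "Y = {}")
    case True
    with mX that show ?thesis by (metis all_not_in_conv card.empty not_less0)
  next
    case False
    obtain u where "u \<in> X" using mX by (metis all_not_in_conv card.empty not_less0)
    with False obtain a b where "a \<in> X" "b \<in> W - X" "(a, b) \<in> E"
      using linked_crossing[OF W sub] unfolding Y_def by blast
    with that show ?thesis unfolding Y_def by blast
  qed
  define nb where "nb = {u \<in> X - {v}. (v, u) \<in> E}"
  have finnb: "finite nb" unfolding nb_def using finX by auto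
  let ?K = "component E (X - {v})"
  \<comment> \<open>A component of \<open>X - {v}\<close> without a neighbour of \<open>v\<close>
    would have no edge to the rest of \<open>X\<close>, although \<open>X\<close> is linked.\<close>
  have cover: "X - {v} \<subseteq> (\<Union>u\<in>nb. ?K u)"
  proof (rule ccontr)
    assume "\<not> ?thesis"
    then obtain z where z: "z \<in> X - {v}" "z \<notin> (\<Union>u\<in>nb. ?K u)" by auto
    have subz: "?K z \<subseteq> X - {v}" using z by (intro component_subset) simp
    obtain a b where ab: "a \<in> ?K z" "b \<in> X - ?K z" "(a, b) \<in> E"
      using linked_crossing[OF lX, of "?K z" z v] v subz component_self by (metis Diff_iff Diff_subset insertI1 order_trans subset_iff)
    have "b = v" using component_closed[OF ab(1) ab(3)] ab(1,2) subz by auto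
    then have "a \<in> nb" using ab subz symD[OF E] unfolding nb_def by auto
    moreover have "z \<in> ?K a"
      using component_disjoint[OF E ab(1) component_self] component_self by metis
    ultimately show False using z(2) by auto
  qed
  \<comment> \<open>\<open>W - ?K u\<close> is linked: \<open>v\<close> reaches \<open>Y\<close>
    through a border edge and each other component through an element of \<open>nb\<close>. With
    more than \<open>m\<close> elements, \<open>?K u\<close> would be a good set smaller than
    \<open>X\<close>.\<close>
  have small: "card (?K u) \<le> m" if u: "u \<in> nb" for u
  proof (rule ccontr)
    assume "\<not> ?thesis"
    then have big_u: "m < card (?K u)" by simp
    have Ku: "?K u \<subseteq> X - {v}" using u unfolding nb_def by (intro component_subset) auto
    let ?R = "W - ?K u"
    have vR: "v \<in> ?R" using v sub Ku by auto
    have "(v, z) \<in> (E \<inter> ?R \<times> ?R)\<^sup>*" if z: "z \<in> ?R" for z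
    proof -
      consider "z = v" | "z \<in> Y" | "z \<in> X - {v}" using z Y_def by auto
      then show ?thesis
      proof cases
        case 2
        then obtain y where y: "y \<in> Y" "(v, y) \<in> E" using vY by auto
        have "(y, z) \<in> (E \<inter> Y \<times> Y)\<^sup>*" using lY y 2 unfolding linked_def by auto
        moreover have YR: "Y \<subseteq> ?R" using Ku unfolding Y_def by auto
        ultimately have "(y, z) \<in> (E \<inter> ?R \<times> ?R)\<^sup>*" by (rule rtrancl_restrict_mono)
        moreover have "(v, y) \<in> E \<inter> ?R \<times> ?R" using y vR YR by auto
        ultimately show ?thesis by (rule converse_rtrancl_into_rtrancl[rotated])
      next
        case 3
        then obtain u' where u': "u' \<in> nb" "z \<in> ?K u'" using cover by auto
        have Ku': "?K u' \<subseteq> X - {v}" using u' unfolding nb_def by (intro component_subset) auto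
        have "?K u' \<inter> ?K u = {}"
          using component_disjoint[OF E] z u'(2) by (metis DiffD2 disjoint_iff)
        then have KR: "?K u' \<subseteq> ?R" using Ku' sub by auto
        have "(u', z) \<in> (E \<inter> ?R \<times> ?R)\<^sup>*"
          using component_path[OF u'(2)] KR by (rule rtrancl_restrict_mono)
        moreover have "(v, u') \<in> E \<inter> ?R \<times> ?R"
          using u'(1) vR KR component_self unfolding nb_def by fastforce
        ultimately show ?thesis by (rule converse_rtrancl_into_rtrancl[rotated])
      qed simp
    qed
    then have "linked E ?R" by (rule linkedI[OF E])
    then have "good (?K u)"
      unfolding good_def using Ku sub big_u linked_component[OF E] by auto
    then have "card X \<le> card (?K u)" by (rule least)
    moreover have "card (?K u) < card X" using Ku v finX by (intro psubset_card_mono) auto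
    ultimately show False by simp
  qed
  have "card (X - {v}) \<le> card (\<Union>u\<in>nb. ?K u)"
    using cover finnb finX component_subset
    by (intro card_mono finite_UN_I) (auto simp: nb_def intro: finite_subset[OF component_subset])
  also have "\<dots> \<le> (\<Sum>u\<in>nb. card (?K u))" by (rule card_UN_le[OF finnb])
  also have "\<dots> \<le> card nb * m" using sum_bounded_above[of nb "\<lambda>u. card (?K u)" m] small by simp
  finally have cardX: "card X \<le> card nb * m + 1" using v finX by (simp add: card_Diff_singleton)
  have cardW: "card W = card X + card Y"
    unfolding Y_def using card_Diff_subset[OF finX sub] card_mono[OF fin sub] by simp
  have nbd: "card nb \<le> card {u \<in> W. (v, u) \<in> E}"
    using sub fin unfolding nb_def by (intro card_mono) auto
  have nb_le: "card nb \<le> d" using nbd deg[of v] v sub by fastforce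
  have "Y \<noteq> {}"
  proof
    assume "Y = {}"
    then have "card W \<le> d * m + 1"
      using cardX cardW mult_le_mono1[OF nb_le, of m] by (simp only: card.empty)
    with big show False by (simp add: mult.commute)
  qed
  then obtain y where y: "y \<in> Y" "(v, y) \<in> E" using vY by auto
  \<comment> \<open>The edge from \<open>v\<close> to \<open>y\<close> leaves at most
    \<open>d - 1\<close> neighbours in \<open>X\<close>. Hence
    \<open>card X \<le> (d - 1) * m + 1\<close>, and more than \<open>m\<close> elements of
    \<open>W\<close> remain for \<open>Y\<close>.\<close>
  have "card nb < card {u \<in> W. (v, u) \<in> E}"
    using sub fin y unfolding nb_def Y_def by (intro psubset_card_mono) auto
  then have "card nb + 1 \<le> d" using deg[of v] v sub by fastforce
  then have "(card nb + 1) * m \<le> d * m" by (rule mult_le_mono1)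
  then have "m < card Y" using cardX cardW big by (simp add: algebra_simps)
  with that[of X Y] sub lX lY mX show ?thesis unfolding Y_def by auto
qed

text \<open>As long as a linked set has more than \<open>m * d + 1\<close> elements,
  \<open>linked_split\<close> cuts it into two smaller linked sets that still have more than
  \<open>m\<close>. So only linked sets of bounded size have to be examined.\<close>

lemma linked_sum_nonneg:
  fixes f :: "'a \<Rightarrow> real"
  assumes E: "sym E" and fin: "finite V"
    and deg: "\<And>v. v \<in> V \<Longrightarrow> card {u. (v, u) \<in> E} \<le> d" "\<And>v. v \<in> V \<Longrightarrow> finite {u. (v, u) \<in> E}"
    and base: "\<And>U. U \<subseteq> V \<Longrightarrow> linked E U \<Longrightarrow> m < card U \<Longrightarrow> card U \<le> m * d + 1 \<Longrightarrow> 0 \<le> sum f U"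
    and "W \<subseteq> V" "linked E W" "m < card W"
  shows "0 \<le> sum f W"
  using assms(6-)
proof (induction "card W" arbitrary: W rule: less_induct)
  case less
  show ?case
  proof (cases "card W \<le> m * d + 1")
    case False
    have finW: "finite W" using finite_subset[OF less.prems(1) fin] .
    have "card {u \<in> W. (v, u) \<in> E} \<le> d" if "v \<in> W" for v
    proof -
      have "v \<in> V" using that less.prems(1) by auto
      have "card {u \<in> W. (v, u) \<in> E} \<le> card {u. (v, u) \<in> E}"
        by (rule card_mono[OF deg(2)[OF \<open>v \<in> V\<close>]]) auto
      with deg(1)[OF \<open>v \<in> V\<close>] show ?thesis by simp
    qed
    then obtain X Y where XY: "X \<union> Y = W" "X \<inter> Y = {}" "linked E X" "linked E Y"
        "m < card X" "m < card Y"
      using linked_split[OF E finW less.prems(2), of d m] False unfolding linorder_not_le by blast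
    have fXY: "finite X" "finite Y" using XY(1) finW by auto
    have "card W = card X + card Y" using card_Un_disjoint[OF fXY XY(2)] XY(1) by simp
    then have "card X < card W" "card Y < card W" using XY(5,6) by simp_all
    moreover have "X \<subseteq> V" "Y \<subseteq> V" using XY(1) less.prems(1) by auto
    ultimately have "0 \<le> sum f X" "0 \<le> sum f Y"
      using less.hyps[of X] less.hyps[of Y] XY by simp_all
    then show ?thesis using sum.union_disjoint[OF fXY XY(2), of f] XY(1) by simp
  qed (rule base[OF less.prems])
qed

text \<open>A component of \<open>W\<close> inherits closedness under \<open>E\<close> from
  \<open>W\<close>, and by symmetry so does the rest. Components are split off one at a
  time.\<close>

lemma closed_sum_nonneg:
  fixes f :: "'a \<Rightarrow> real"
  assumes E: "sym E" and fin: "finite V"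
    and comps: "\<And>K. K \<subseteq> V \<Longrightarrow> K \<noteq> {} \<Longrightarrow> linked E K \<Longrightarrow> E `` K \<subseteq> K \<Longrightarrow> 0 \<le> sum f K"
    and "W \<subseteq> V" "E `` W \<subseteq> W"
  shows "0 \<le> sum f W"
  using assms(4-)
proof (induction "card W" arbitrary: W rule: less_induct)
  case less
  show ?case
  proof (cases "W = {}")
    case False
    then obtain v where v: "v \<in> W" by auto
    have finW: "finite W" using finite_subset[OF less.prems(1) fin] .
    define K where "K = component E W v"
    have K: "K \<subseteq> W" "v \<in> K" "linked E K"
      unfolding K_def using component_subset[OF v] component_self linked_component[OF E] by auto
    have cl: "E `` K \<subseteq> K"
    proof
      fix z assume "z \<in> E `` K"
      then obtain y where y: "y \<in> K" "(y, z) \<in> E" by auto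
      moreover have "y \<in> W" using y K(1) by auto
      moreover have "z \<in> W" using y \<open>y \<in> W\<close> less.prems(2) by auto
      ultimately show "z \<in> K" using component_closed[of y E W v z] unfolding K_def by simp
    qed
    have "E `` (W - K) \<subseteq> W - K"
    proof
      fix z assume "z \<in> E `` (W - K)"
      then obtain y where y: "y \<in> W" "y \<notin> K" "(y, z) \<in> E" by auto
      then have "(z, y) \<in> E" using symD[OF E] by simp
      with y cl less.prems(2) show "z \<in> W - K" by auto
    qed
    moreover have "card (W - K) < card W"
      using v K(2) finW by (intro psubset_card_mono) auto
    moreover have "W - K \<subseteq> V" "K \<subseteq> V" using K(1) less.prems(1) by auto
    ultimately have "0 \<le> sum f (W - K)" "0 \<le> sum f K"
      using less.hyps[of "W - K"] comps[of K] K(2,3) cl by auto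
    then show ?thesis using sum.subset_diff[OF K(1) finW, of f] by simp
  qed simp
qed

text \<open>Let \<open>L\<close> be the largest weight and \<open>D\<close> the set of elements
  below it. On \<open>U - D\<close> the quotient \<open>w a * q a / L\<close> equals
  \<open>q a\<close>, and the induction treats \<open>D\<close> with the bound \<open>L\<close>.
  Passing from \<open>L\<close> to a larger \<open>M\<close> is harmless because the weighted sum
  over \<open>U\<close> is nonnegative.\<close>

lemma abel_sum_nonneg:
  fixes w q :: "'a \<Rightarrow> real"
  assumes "finite U" "\<And>a. a \<in> U \<Longrightarrow> 0 < w a"
    and "\<And>D. D \<subseteq> U \<Longrightarrow> (\<And>a b. a \<in> D \<Longrightarrow> b \<in> U \<Longrightarrow> w b \<le> w a \<Longrightarrow> b \<in> D) \<Longrightarrow>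
      0 \<le> (\<Sum>a\<in>D. w a * q a)"
    and "0 < M" "\<And>a. a \<in> U \<Longrightarrow> w a \<le> M"
  shows "(\<Sum>a\<in>U. w a * q a) / M \<le> sum q U"
  using assms
proof (induction "card U" arbitrary: U M rule: less_induct)
  case less
  show ?case
  proof (cases "U = {}")
    case False
    define L where "L = Max (w ` U)"
    define D where "D = {a \<in> U. w a < L}"
    have Lin: "L \<in> w ` U" and Lmax: "\<And>a. a \<in> U \<Longrightarrow> w a \<le> L"
      unfolding L_def using less.prems(1) False by auto
    have L0: "0 < L" and LM: "L \<le> M" using Lin less.prems(2,5) by auto
    have DU: "D \<subseteq> U" unfolding D_def by auto
    have "D \<subset> U" using Lin unfolding D_def by auto
    then have "card D < card U" using less.prems(1) by (rule psubset_card_mono[rotated])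
    \<comment> \<open>Everything in \<open>U\<close> that is no heavier than an element of
      \<open>D\<close> lies in \<open>D\<close>, so sets closed downwards in \<open>D\<close> are
      closed downwards in \<open>U\<close>.\<close>
    moreover have "0 \<le> (\<Sum>a\<in>D'. w a * q a)"
      if D': "D' \<subseteq> D" "\<And>a b. a \<in> D' \<Longrightarrow> b \<in> D \<Longrightarrow> w b \<le> w a \<Longrightarrow> b \<in> D'" for D'
    proof (rule less.prems(3))
      show "b \<in> D'" if "a \<in> D'" "b \<in> U" "w b \<le> w a" for a b
        using D'(1) D'(2)[of a b] that unfolding D_def by fastforce
    qed (use D' DU in auto)
    ultimately have IH: "(\<Sum>a\<in>D. w a * q a) / L \<le> sum q D"
      using DU less.prems(1,2) L0 by (intro less.hyps) (auto simp: D_def intro: finite_subset)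
    have "(\<Sum>a\<in>U - D. w a * q a) / L = (\<Sum>a\<in>U - D. q a)"
      unfolding sum_divide_distrib
    proof (rule sum.cong)
      fix a assume "a \<in> U - D"
      then have "w a = L" using Lmax unfolding D_def by fastforce
      then show "w a * q a / L = q a" using L0 by simp
    qed simp
    with IH have "(\<Sum>a\<in>U. w a * q a) / L \<le> sum q U"
      using sum.subset_diff[OF DU less.prems(1), of q]
        sum.subset_diff[OF DU less.prems(1), of "\<lambda>a. w a * q a"]
      by (simp add: add_divide_distrib)
    moreover have "0 \<le> (\<Sum>a\<in>U. w a * q a)" by (rule less.prems(3)) auto
    then have "(\<Sum>a\<in>U. w a * q a) / M \<le> (\<Sum>a\<in>U. w a * q a) / L"
      using L0 LM by (intro divide_left_mono) auto
    ultimately show ?thesis by simp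
  qed simp
qed

subsection \<open>Exchange-optimal sets\<close>

lemma weight_Un_disjoint:
  "finite X \<Longrightarrow> finite Y \<Longrightarrow> X \<inter> Y = {} \<Longrightarrow> weight w (X \<union> Y) = weight w X + weight w Y"
  unfolding weight_def by (rule sum.union_disjoint)

lemma sum_UN_le:
  fixes f :: "'a \<Rightarrow> real"
  assumes "finite I" "\<And>i. i \<in> I \<Longrightarrow> finite (B i)" "\<And>x. 0 \<le> f x"
  shows "sum f (\<Union>i\<in>I. B i) \<le> (\<Sum>i\<in>I. sum f (B i))"
  using assms(1,2)
proof (induction I rule: finite_induct)
  case (insert i I)
  then have "sum f (B i \<union> (\<Union>i\<in>I. B i)) + sum f (B i \<inter> (\<Union>i\<in>I. B i))
      = sum f (B i) + sum f (\<Union>i\<in>I. B i)"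
    by (intro sum.union_inter) auto
  moreover have "0 \<le> sum f (B i \<inter> (\<Union>i\<in>I. B i))" by (intro sum_nonneg assms(3))
  ultimately show ?case using insert by simp
qed simp

text \<open>\<open>S\<close> plays the output of the search, \<open>Q\<close> the independent set
  compared with it, and \<open>N q\<close> the neighbourhood of \<open>q\<close> in
  \<open>S\<close>. \<open>Q\<close> may meet \<open>S\<close>; in the application a common element
  \<open>q\<close> has \<open>N q = {q}\<close>.\<close>

locale exchange_optimum =
  fixes S Q :: "'a set" and w :: "'a \<Rightarrow> real" and N :: "'a \<Rightarrow> 'a set" and k s :: nat
  assumes finite_S: "finite S" and finite_Q: "finite Q"
    and w_pos: "v \<in> S \<union> Q \<Longrightarrow> 0 < w v"
    and N_subset: "q \<in> Q \<Longrightarrow> N q \<subseteq> S"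
    and N_nonempty: "q \<in> Q \<Longrightarrow> N q \<noteq> {}"
    and card_N: "q \<in> Q \<Longrightarrow> card (N q) \<le> k"
    and card_N_inv: "a \<in> S \<Longrightarrow> card {q \<in> Q. a \<in> N q} \<le> k"
    and local_opt: "C \<subseteq> Q \<Longrightarrow> card C \<le> s * k \<Longrightarrow> sq_weight w C \<le> sq_weight w (\<Union>(N ` C))"
begin

section \<open>Apexes, clusters and the exchange inequality\<close>

definition apex :: "'a \<Rightarrow> 'a" where
  "apex q = (SOME a. a \<in> N q \<and> (\<forall>b\<in>N q. w b \<le> w a))"

definition cluster :: "'a set \<Rightarrow> 'a set" where
  "cluster U = {q \<in> Q. apex q \<in> U}"

lemma finite_N: "q \<in> Q \<Longrightarrow> finite (N q)"
  using N_subset finite_S finite_subset by blast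

lemma apex_props:
  assumes "q \<in> Q"
  shows apex_in_N: "apex q \<in> N q" and apex_max: "b \<in> N q \<Longrightarrow> w b \<le> w (apex q)"
proof -
  have "Max (w ` N q) \<in> w ` N q" using assms finite_N N_nonempty by (intro Max_in) auto
  then obtain a where "a \<in> N q" "w a = Max (w ` N q)" by auto
  then have "\<exists>a. a \<in> N q \<and> (\<forall>b\<in>N q. w b \<le> w a)" using finite_N[OF assms] by auto
  from someI_ex[OF this] have "apex q \<in> N q \<and> (\<forall>b\<in>N q. w b \<le> w (apex q))"
    unfolding apex_def .
  then show "apex q \<in> N q" "b \<in> N q \<Longrightarrow> w b \<le> w (apex q)" by auto
qed

lemma apex_in_S: "q \<in> Q \<Longrightarrow> apex q \<in> S"
  using apex_in_N N_subset by blast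

lemma finite_cluster: "finite (cluster U)"
  unfolding cluster_def using finite_Q by simp

lemma cluster_UN: "cluster U = (\<Union>a\<in>U. cluster {a})"
  unfolding cluster_def by auto

lemma sum_cluster: "finite U \<Longrightarrow> (\<Sum>a\<in>U. \<Sum>q\<in>cluster {a}. f q) = (\<Sum>q\<in>cluster U. f q)"
  by (subst (2) cluster_UN, rule sum.UNION_disjoint[symmetric])
    (auto simp: finite_cluster, auto simp: cluster_def)

lemma card_cluster:
  assumes "U \<subseteq> S"
  shows "card (cluster U) \<le> card U * k"
proof -
  have fin: "finite U" using assms finite_S finite_subset by auto
  have "card (cluster U) \<le> (\<Sum>a\<in>U. card (cluster {a}))"
    by (subst cluster_UN) (rule card_UN_le[OF fin])
  also have "\<dots> \<le> (\<Sum>a\<in>U. k)"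
  proof (rule sum_mono)
    fix a assume "a \<in> U"
    have "card (cluster {a}) \<le> card {q \<in> Q. a \<in> N q}"
      using finite_Q apex_in_N unfolding cluster_def by (intro card_mono) auto
    also have "\<dots> \<le> k" using \<open>a \<in> U\<close> assms by (intro card_N_inv) auto
    finally show "card (cluster {a}) \<le> k" .
  qed
  finally show ?thesis by simp
qed

text \<open>The set \<open>cluster U\<close> is exchanged in; \<open>card_cluster\<close> keeps it
  within the limit \<open>s * k\<close>. Neighbours outside \<open>U\<close> are counted once for
  each \<open>q\<close> that sees them, which only weakens the inequality.\<close>

lemma exchange:
  assumes "U \<subseteq> S" "card U \<le> s"
  shows "(\<Sum>q\<in>cluster U. (w q)\<^sup>2 - sq_weight w (N q - U)) \<le> sq_weight w U"
proof -
  have fin: "finite U" using assms finite_S finite_subset by auto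
  have sub: "cluster U \<subseteq> Q" unfolding cluster_def by auto
  have "card (cluster U) \<le> s * k"
    using card_cluster[OF assms(1)] assms(2) mult_le_mono1 le_trans by blast
  then have "sq_weight w (cluster U) \<le> sq_weight w (\<Union>(N ` cluster U))"
    by (intro local_opt sub)
  also have "\<dots> \<le> sq_weight w (U \<union> (\<Union>q\<in>cluster U. N q - U))"
    unfolding sq_weight_def
    using fin finite_cluster sub finite_N by (intro sum_mono2) auto
  also have "\<dots> \<le> sq_weight w U + sq_weight w (\<Union>q\<in>cluster U. N q - U)"
    unfolding sq_weight_def using fin finite_cluster sub finite_N
    by (intro order_eq_refl sum.union_disjoint) auto
  also have "sq_weight w (\<Union>q\<in>cluster U. N q - U) \<le> (\<Sum>q\<in>cluster U. sq_weight w (N q - U))"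
    unfolding sq_weight_def using finite_cluster sub finite_N
    by (intro sum_UN_le) auto
  finally show ?thesis unfolding sq_weight_def[of w "cluster U"] sum_subtractf by simp
qed

end

text \<open>Eventually \<open>r = sqrt (1 - \<epsilon>)\<close>, which turns
  \<open>r\<^sup>2 / (1 + r\<^sup>2)\<close> into \<open>(1 - \<epsilon>) / (2 - \<epsilon>)\<close>
  and \<open>2 * r\<^sup>2 / (2 + r\<^sup>2)\<close> into
  \<open>2 * (1 - \<epsilon>) / (3 - \<epsilon>)\<close>.\<close>

locale exchange_optimum_scale = exchange_optimum +
  fixes r :: real
  assumes r_pos: "0 < r" and r_le_1: "r \<le> 1"
begin

section \<open>Heavy and light neighbours, charge and slack\<close>

definition heavy :: "'a \<Rightarrow> 'a set" where
  "heavy q = {b \<in> N q. r\<^sup>2 * w (apex q) \<le> w b}"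

definition light :: "'a \<Rightarrow> 'a set" where
  "light q = N q - heavy q"

text \<open>
  Twice what the apex of q gets, beyond half of its own weight, when heavy neighbours b are paid w b / 2 and
  light ones r * w b / 2; slack is twice what b misses.
\<close>

definition charge :: "'a \<Rightarrow> real" where
  "charge q = 2 * w q - weight w (heavy q) - r * weight w (light q)"

definition slack :: "'a \<Rightarrow> real" where
  "slack b = w b - (\<Sum>q\<in>cluster {b}. charge q)"

lemma r2_le_r: "r\<^sup>2 \<le> r"
  using r_pos r_le_1 by (simp add: power2_eq_square mult_left_le_one_le)

lemma r2_le_1: "r\<^sup>2 \<le> 1"
  using r2_le_r r_le_1 by simp

lemma heavy_props:
  assumes "q \<in> Q"
  shows "heavy q \<subseteq> S" "heavy q \<subseteq> N q" "finite (heavy q)" "finite (light q)" "apex q \<in> heavy q"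
    "N q = heavy q \<union> light q" "heavy q \<inter> light q = {}" "light q \<subseteq> S"
proof -
  have "r\<^sup>2 * w (apex q) \<le> 1 * w (apex q)"
    using r2_le_1 w_pos[of "apex q"] apex_in_S[OF assms] by (intro mult_right_mono) auto
  then show "apex q \<in> heavy q" unfolding heavy_def using apex_in_N[OF assms] by auto
qed (use N_subset[OF assms] finite_N[OF assms] in \<open>auto simp: heavy_def light_def\<close>)

lemma sq_weight_light:
  assumes "q \<in> Q"
  shows "sq_weight w (light q) \<le> r\<^sup>2 * w (apex q) * weight w (light q)"
  unfolding sq_weight_def weight_def sum_distrib_left
proof (rule sum_mono)
  fix b assume b: "b \<in> light q"
  then have "w b \<le> r\<^sup>2 * w (apex q)" unfolding light_def heavy_def by auto
  moreover have "0 < w b" using b heavy_props(8)[OF assms] w_pos by auto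
  ultimately show "(w b)\<^sup>2 \<le> r\<^sup>2 * w (apex q) * w b"
    by (simp add: power2_eq_square mult_right_mono)
qed

lemma weight_N:
  assumes "q \<in> Q"
  shows "weight w (N q) = weight w (heavy q) + weight w (light q)"
  using weight_Un_disjoint heavy_props[OF assms] by metis

lemma weight_nonneg: "X \<subseteq> S \<Longrightarrow> 0 \<le> weight w X"
  unfolding weight_def using w_pos by (intro sum_nonneg) (auto intro: less_imp_le)

text \<open>Write \<open>a\<close> for the apex. A heavy \<open>b\<close> outside \<open>U\<close>
  costs at most \<open>w a * w b\<close>, the light ones at most \<open>r * w a\<close> times their
  weight since \<open>r\<^sup>2 \<le> r\<close>, and \<open>(w q - w a)\<^sup>2 \<ge> 0\<close>
  handles \<open>w q\<close>. Heavy neighbours inside \<open>U\<close> cost nothing; this saving is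
  the extra term.\<close>

lemma gain:
  assumes "q \<in> cluster U"
  shows "w (apex q) * (charge q + weight w (heavy q \<inter> U - {apex q}))
    \<le> (w q)\<^sup>2 - sq_weight w (N q - U)"
proof -
  define a where "a = apex q"
  have q: "q \<in> Q" "a \<in> U" using assms unfolding cluster_def a_def by auto
  note h = heavy_props[OF q(1)]
  have wa: "0 < w a" using w_pos apex_in_S[OF q(1)] unfolding a_def by auto
  have "N q - U \<subseteq> (heavy q - U) \<union> light q" using h(6) by auto
  then have "sq_weight w (N q - U) \<le> sq_weight w ((heavy q - U) \<union> light q)"
    unfolding sq_weight_def using h(3,4) by (intro sum_mono2) auto
  also have "\<dots> = sq_weight w (heavy q - U) + sq_weight w (light q)"
    unfolding sq_weight_def using h(3,4,7) by (intro sum.union_disjoint) auto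
  also have "sq_weight w (heavy q - U) \<le> w a * weight w (heavy q - U)"
    unfolding sq_weight_def weight_def sum_distrib_left
  proof (rule sum_mono)
    fix b assume "b \<in> heavy q - U"
    then have "w b \<le> w a" "0 < w b"
      using apex_max[OF q(1)] h(1,2) w_pos unfolding a_def by auto
    then show "(w b)\<^sup>2 \<le> w a * w b" by (simp add: power2_eq_square mult_right_mono)
  qed
  also have "sq_weight w (light q) \<le> r * (w a * weight w (light q))"
  proof -
    have "r\<^sup>2 * (w a * weight w (light q)) \<le> r * (w a * weight w (light q))"
      using r2_le_r wa weight_nonneg[OF h(8)] by (intro mult_right_mono) auto
    with sq_weight_light[OF q(1)] show ?thesis unfolding a_def by (simp add: mult.assoc)
  qed
  finally have 1: "sq_weight w (N q - U)
    \<le> w a * weight w (heavy q - U) + r * (w a * weight w (light q))" by simp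
  have "weight w (heavy q) = w a + weight w (heavy q \<inter> U - {a}) + weight w (heavy q - U)"
  proof -
    have "heavy q = insert a (heavy q \<inter> U - {a}) \<union> (heavy q - U)"
      using h(5) q unfolding a_def by auto
    then have "weight w (heavy q) = weight w (insert a (heavy q \<inter> U - {a}) \<union> (heavy q - U))"
      by simp
    also have "\<dots> = weight w (insert a (heavy q \<inter> U - {a})) + weight w (heavy q - U)"
      using h(3) q(2) by (intro weight_Un_disjoint) auto
    also have "weight w (insert a (heavy q \<inter> U - {a})) = w a + weight w (heavy q \<inter> U - {a})"
      using h(3) unfolding weight_def by (subst sum.insert) auto
    finally show ?thesis .
  qed
  then have 2: "w a * (charge q + weight w (heavy q \<inter> U - {a}))
    = 2 * w a * w q - (w a)\<^sup>2 - w a * weight w (heavy q - U) - r * (w a * weight w (light q))"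
    unfolding charge_def by (simp add: algebra_simps power2_eq_square)
  have "0 \<le> (w q - w a)\<^sup>2" by simp
  then have 3: "2 * w a * w q - (w a)\<^sup>2 \<le> (w q)\<^sup>2" by (simp add: power2_diff algebra_simps)
  show ?thesis using 1 2 3 unfolding a_def by linarith
qed

text \<open>Only light neighbours are left outside \<open>U\<close>, and their cost keeps the full
  factor \<open>r\<^sup>2\<close>. This leaves room for the square of
  \<open>w q - r * w (apex q)\<close> in place of \<open>w q - w (apex q)\<close>.\<close>

lemma gain_discounted:
  assumes "q \<in> cluster U" "heavy q \<subseteq> U"
  shows "r * w (apex q) * (2 * w q - r * w (apex q) - r * weight w (light q))
    \<le> (w q)\<^sup>2 - sq_weight w (N q - U)"
proof -
  have q: "q \<in> Q" using assms unfolding cluster_def by auto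
  note h = heavy_props[OF q]
  have "sq_weight w (N q - U) \<le> sq_weight w (light q)"
    unfolding sq_weight_def using h(4,6) assms(2) by (intro sum_mono2) auto
  also have "\<dots> \<le> r\<^sup>2 * w (apex q) * weight w (light q)" by (rule sq_weight_light[OF q])
  moreover have "0 \<le> (w q - r * w (apex q))\<^sup>2" by simp
  ultimately show ?thesis by (simp add: power2_diff power_mult_distrib algebra_simps power2_eq_square)
qed

text \<open>The exchange inequality weights the term of each \<open>a\<close> with
  \<open>w a\<close>; \<open>abel_sum_nonneg\<close> removes these weights.\<close>

lemma slack_bound:
  assumes "U \<subseteq> S" "card U \<le> s"
  shows "(\<Sum>q\<in>cluster U. weight w (heavy q \<inter> U - {apex q})) \<le> (\<Sum>b\<in>U. slack b)"
proof -
  let ?p = "\<lambda>q. weight w (heavy q \<inter> U - {apex q})"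
  define f where "f b = slack b - (\<Sum>q\<in>cluster {b}. ?p q)" for b
  have finU: "finite U" using assms finite_S finite_subset by auto
  have pos: "0 < w a" if "a \<in> U" for a using that assms w_pos by auto
  have nonneg: "0 \<le> (\<Sum>a\<in>D. w a * f a)"
    if D: "D \<subseteq> U" "\<And>a b. a \<in> D \<Longrightarrow> b \<in> U \<Longrightarrow> w b \<le> w a \<Longrightarrow> b \<in> D" for D
  proof -
    have finD: "finite D" using D(1) finU finite_subset by auto
    have eq: "(\<Sum>a\<in>D. w a * f a)
      = sq_weight w D - (\<Sum>a\<in>D. \<Sum>q\<in>cluster {a}. w a * (charge q + ?p q))"
      unfolding sq_weight_def sum_subtractf[symmetric] f_def slack_def
      by (intro sum.cong)
        (auto simp: right_diff_distrib sum_distrib_left sum.distrib distrib_left power2_eq_square)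
    have "(\<Sum>a\<in>D. \<Sum>q\<in>cluster {a}. w a * (charge q + ?p q))
      = (\<Sum>a\<in>D. \<Sum>q\<in>cluster {a}. w (apex q) * (charge q + ?p q))"
      by (intro sum.cong) (auto simp: cluster_def)
    also have "\<dots> = (\<Sum>q\<in>cluster D. w (apex q) * (charge q + ?p q))"
      by (rule sum_cluster[OF finD])
    also have "\<dots> \<le> (\<Sum>q\<in>cluster D. (w q)\<^sup>2 - sq_weight w (N q - D))"
    proof (rule sum_mono)
      fix q assume q: "q \<in> cluster D"
      then have qQ: "q \<in> Q" "apex q \<in> D" by (auto simp: cluster_def)
      \<comment> \<open>Heavy neighbours are no heavier than the apex, so those in \<open>U\<close>
        already lie in the downward closed \<open>D\<close>.\<close>
      have "heavy q \<inter> U = heavy q \<inter> D"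
        using D(1) D(2)[OF qQ(2)] apex_max[OF qQ(1)] heavy_props(2)[OF qQ(1)] by auto
      with gain[OF q] show "w (apex q) * (charge q + ?p q) \<le> (w q)\<^sup>2 - sq_weight w (N q - D)"
        by simp
    qed
    also have "\<dots> \<le> sq_weight w D"
      using D(1) assms card_mono[OF finU D(1)] by (intro exchange) auto
    finally show ?thesis unfolding eq by simp
  qed
  \<comment> \<open>Any positive upper bound serves, as only the sign of the quotient matters; the
    inserted 1 covers empty \<open>U\<close>.\<close>
  define M where "M = Max (insert 1 (w ` U))"
  have M: "1 \<le> M" "\<And>a. a \<in> U \<Longrightarrow> w a \<le> M"
    unfolding M_def using finU by (auto intro: Max_ge)
  have "0 \<le> (\<Sum>a\<in>U. w a * f a) / M" using M(1) by (intro divide_nonneg_nonneg nonneg) auto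
  also have "\<dots> \<le> sum f U"
    using abel_sum_nonneg[OF finU pos nonneg] M by fastforce
  finally show ?thesis unfolding f_def sum_subtractf sum_cluster[OF finU] by simp
qed

section \<open>The graph joining apexes to heavy neighbours\<close>

definition adj :: "('a \<times> 'a) set" where
  "adj = {(u, v). u \<noteq> v \<and> (\<exists>q\<in>Q. (u = apex q \<and> v \<in> heavy q) \<or> (v = apex q \<and> u \<in> heavy q))}"

text \<open>These are the edges inside \<open>U\<close> with multiplicity: parallel edges that stem
  from different \<open>q\<close> stay distinct, and \<open>degree\<close> counts each of
  them.\<close>

definition pairs :: "'a set \<Rightarrow> ('a \<times> 'a) set" where
  "pairs U = (SIGMA q:cluster U. heavy q \<inter> U - {apex q})"

definition degree :: "'a set \<Rightarrow> 'a \<Rightarrow> nat" where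
  "degree U v = card {p \<in> pairs U. v = apex (fst p) \<or> v = snd p}"

text \<open>
  Twice what b gets when q pays r * w c / 2 to each neighbour c and the remainder to its apex.
  Over a component this has the same sum as the distribution that defines charge, since
  all heavy neighbours of q lie in the same component.
\<close>

definition share :: "'a \<Rightarrow> real" where
  "share b = r * w b * card {q \<in> Q. b \<in> N q} + (\<Sum>q\<in>cluster {b}. 2 * w q - r * weight w (N q))"

lemma sym_adj: "sym adj"
  by (rule symI) (auto simp: adj_def)

text \<open>A neighbour of \<open>v\<close> shares some \<open>N q\<close> with \<open>v\<close>. At
  most \<open>k\<close> such \<open>q\<close> exist, each with at most \<open>k - 1\<close> further
  elements.\<close>

lemma adj_degree:
  assumes "v \<in> S"
  shows "finite {u. (v, u) \<in> adj}" "card {u. (v, u) \<in> adj} \<le> k * (k - 1)"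
proof -
  let ?I = "{q \<in> Q. v \<in> N q}"
  have fin: "finite ?I" using finite_Q by auto
  have sub: "{u. (v, u) \<in> adj} \<subseteq> (\<Union>q\<in>?I. N q - {v})"
    unfolding adj_def using heavy_props(2) apex_in_N by auto
  moreover have finU: "finite (\<Union>q\<in>?I. N q - {v})" using fin finite_N by auto
  ultimately show "finite {u. (v, u) \<in> adj}" by (rule finite_subset)
  have "card {u. (v, u) \<in> adj} \<le> card (\<Union>q\<in>?I. N q - {v})" using finU sub by (rule card_mono)
  also have "\<dots> \<le> (\<Sum>q\<in>?I. card (N q - {v}))" by (rule card_UN_le[OF fin])
  also have "\<dots> \<le> (\<Sum>q\<in>?I. k - 1)"
  proof (rule sum_mono)
    fix q assume "q \<in> ?I"
    then show "card (N q - {v}) \<le> k - 1" using card_N[of q] by simp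
  qed
  also have "\<dots> \<le> k * (k - 1)" using card_N_inv[OF assms] by simp
  finally show "card {u. (v, u) \<in> adj} \<le> k * (k - 1)" .
qed

lemma finite_pairs: "finite (pairs U)"
  unfolding pairs_def using finite_cluster heavy_props(3) by (intro finite_SigmaI) (auto simp: cluster_def)

lemma pairs_props:
  assumes "p \<in> pairs U"
  shows "fst p \<in> Q" "apex (fst p) \<in> U" "snd p \<in> U" "snd p \<noteq> apex (fst p)"
    "snd p \<in> heavy (fst p)"
    "w (snd p) \<le> w (apex (fst p))" "r\<^sup>2 * w (apex (fst p)) \<le> w (snd p)"
proof -
  show *: "fst p \<in> Q" "apex (fst p) \<in> U" "snd p \<in> U" "snd p \<noteq> apex (fst p)"
    "snd p \<in> heavy (fst p)"
    using assms unfolding pairs_def cluster_def by auto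
  show "w (snd p) \<le> w (apex (fst p))"
    using apex_max[OF *(1)] heavy_props(2)[OF *(1)] *(5) by auto
  show "r\<^sup>2 * w (apex (fst p)) \<le> w (snd p)" using *(5) unfolding heavy_def by auto
qed

lemma adj_pairs:
  assumes "(u, v) \<in> adj" "u \<in> U" "v \<in> U"
  shows "\<exists>p\<in>pairs U. {apex (fst p), snd p} = {u, v}"
proof -
  obtain q where q: "q \<in> Q" "u \<noteq> v" "(u = apex q \<and> v \<in> heavy q) \<or> (v = apex q \<and> u \<in> heavy q)"
    using assms(1) unfolding adj_def by auto
  then have "(q, if u = apex q then v else u) \<in> pairs U"
    using assms(2,3) unfolding pairs_def cluster_def by auto
  moreover have "{apex q, if u = apex q then v else u} = {u, v}" using q by auto
  ultimately show ?thesis by (intro bexI[of _ "(q, if u = apex q then v else u)"]) auto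
qed

lemma sum_over_pairs:
  assumes "finite U"
  shows "(\<Sum>p\<in>pairs U. f (apex (fst p)) + f (snd p)) = (\<Sum>v\<in>U. real (degree U v) * f v)"
proof -
  have "(\<Sum>p\<in>pairs U. f (apex (fst p)) + f (snd p))
    = (\<Sum>p\<in>pairs U. \<Sum>v\<in>U. if v = apex (fst p) \<or> v = snd p then f v else 0)"
  proof (rule sum.cong)
    fix p assume p: "p \<in> pairs U"
    have "{v \<in> U. v = apex (fst p) \<or> v = snd p} = {apex (fst p), snd p}"
      using pairs_props[OF p] by auto
    then show "f (apex (fst p)) + f (snd p)
      = (\<Sum>v\<in>U. if v = apex (fst p) \<or> v = snd p then f v else 0)"
      using pairs_props(4)[OF p] assms by (simp add: sum.If_cases Int_def)
  qed simp
  also have "\<dots> = (\<Sum>v\<in>U. \<Sum>p\<in>pairs U. if v = apex (fst p) \<or> v = snd p then f v else 0)"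
    by (rule sum.swap)
  also have "\<dots> = (\<Sum>v\<in>U. real (degree U v) * f v)"
    using finite_pairs unfolding degree_def by (simp add: sum.If_cases Int_def)
  finally show ?thesis .
qed

text \<open>Discharging: in \<open>slack_bound\<close> each pair contributes the weight of its
  second component, which it may divide between its two ends according to \<open>f\<close>.\<close>

lemma slack_by_pairs:
  assumes U: "U \<subseteq> S" "card U \<le> s"
    and pay: "\<And>p. p \<in> pairs U \<Longrightarrow> f (apex (fst p)) + f (snd p) \<le> w (snd p)"
    and get: "\<And>v. v \<in> U \<Longrightarrow> \<rho> * w v \<le> real (degree U v) * f v"
  shows "\<rho> * weight w U \<le> (\<Sum>b\<in>U. slack b)"
proof -
  have fin: "finite U" using finite_subset[OF U(1) finite_S] .
  have "\<rho> * weight w U \<le> (\<Sum>v\<in>U. real (degree U v) * f v)"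
    unfolding weight_def sum_distrib_left using get by (rule sum_mono)
  also have "\<dots> = (\<Sum>p\<in>pairs U. f (apex (fst p)) + f (snd p))" using sum_over_pairs[OF fin] by simp
  also have "\<dots> \<le> (\<Sum>p\<in>pairs U. w (snd p))" using pay by (rule sum_mono)
  also have "\<dots> = (\<Sum>q\<in>cluster U. weight w (heavy q \<inter> U - {apex q}))"
    unfolding weight_def pairs_def using finite_cluster heavy_props(3)
    by (subst sum.Sigma) (auto simp: cluster_def case_prod_unfold)
  also have "\<dots> \<le> (\<Sum>b\<in>U. slack b)" using U by (rule slack_bound)
  finally show ?thesis .
qed

lemma degree_pos:
  assumes "p \<in> pairs U" "v = apex (fst p) \<or> v = snd p"
  shows "0 < degree U v"
proof -
  have "card {p} \<le> degree U v"
    unfolding degree_def using assms finite_pairs by (intro card_mono) auto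
  then show ?thesis by simp
qed

lemma degree_ge_2:
  assumes "p \<in> pairs U" "v = apex (fst p) \<or> v = snd p"
    "p' \<in> pairs U" "v = apex (fst p') \<or> v = snd p'" "p \<noteq> p'"
  shows "2 \<le> degree U v"
proof -
  have "card {p, p'} \<le> degree U v"
    unfolding degree_def using assms finite_pairs by (intro card_mono) auto
  with assms(5) show ?thesis by simp
qed

lemma linked_degree_pos:
  assumes "linked adj U" "1 < card U" "v \<in> U"
  shows "0 < degree U v"
proof -
  have "U \<noteq> {v}" using assms(2) by auto
  then obtain u where "u \<in> U - {v}" using assms(3) by auto
  then obtain b where "b \<in> U - {v}" "(v, b) \<in> adj"
    using linked_crossing[OF assms(1), of "{v}" v u] assms(3) by auto
  then obtain p where "p \<in> pairs U" "{apex (fst p), snd p} = {v, b}"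
    using adj_pairs assms(3) by blast
  then show ?thesis by (intro degree_pos[of p]) auto
qed

text \<open>A third vertex forces an edge to leave the two ends of \<open>p\<close>; this edge is a
  second pair at one of them.\<close>

lemma linked_no_isolated_pair:
  assumes "linked adj U" "2 < card U" "p \<in> pairs U"
  shows "2 \<le> degree U (apex (fst p)) \<or> 2 \<le> degree U (snd p)"
proof -
  let ?X = "{apex (fst p), snd p}"
  have X: "?X \<subseteq> U" "card ?X = 2" using pairs_props[OF assms(3)] by auto
  have "U \<noteq> ?X" using X(2) assms(2) by (metis less_irrefl)
  with X(1) have "U - ?X \<noteq> {}" by (metis Diff_eq_empty_iff subset_antisym)
  then obtain z where z: "z \<in> U - ?X" by (metis all_not_in_conv)
  have "\<exists>u\<in>?X. \<exists>b\<in>U - ?X. (u, b) \<in> adj"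
    by (rule linked_crossing[OF assms(1) X(1) _ z, of "apex (fst p)"]) simp
  then obtain u b where ub: "u \<in> ?X" "b \<in> U - ?X" "(u, b) \<in> adj" by (elim bexE) (rule that)
  have "u \<in> U" "b \<in> U" using ub(1,2) X(1) by (meson subsetD DiffD1)+
  then obtain p' where p': "p' \<in> pairs U" "{apex (fst p'), snd p'} = {u, b}"
    using adj_pairs[OF ub(3) \<open>u \<in> U\<close> \<open>b \<in> U\<close>] by (elim bexE) (rule that)
  have "u = apex (fst p') \<or> u = snd p'" "b = apex (fst p') \<or> b = snd p'"
    using p'(2) unfolding doubleton_eq_iff by auto
  then have "p \<noteq> p'" using ub by auto
  then have "2 \<le> degree U u"
    using p' ub(1) by (intro degree_ge_2[OF assms(3) _ p'(1)]) auto
  with ub(1) show ?thesis by auto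
qed

text \<open>For ends of weights \<open>a\<close> and \<open>b\<close> with
  \<open>x * a \<le> b\<close>, where \<open>x = r\<^sup>2\<close>, one has
  \<open>x * (a + b) \<le> (1 + x) * b\<close>. So a pair can afford the fraction
  \<open>x / (1 + x)\<close> of both ends.\<close>

lemma slack_edges:
  assumes U: "U \<subseteq> S" "card U \<le> s" and deg: "\<And>v. v \<in> U \<Longrightarrow> 0 < degree U v"
  shows "r\<^sup>2 / (1 + r\<^sup>2) * weight w U \<le> (\<Sum>b\<in>U. slack b)"
proof (rule slack_by_pairs[OF U, where f = "\<lambda>v. r\<^sup>2 / (1 + r\<^sup>2) * w v"])
  have r1: "0 < 1 + r\<^sup>2" by (simp add: add_pos_nonneg)
  fix p assume p: "p \<in> pairs U"
  have "r\<^sup>2 * (w (apex (fst p)) + w (snd p)) \<le> (1 + r\<^sup>2) * w (snd p)"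
    using pairs_props(7)[OF p] by (simp add: algebra_simps)
  then show "r\<^sup>2 / (1 + r\<^sup>2) * w (apex (fst p)) + r\<^sup>2 / (1 + r\<^sup>2) * w (snd p) \<le> w (snd p)"
    using r1 unfolding distrib_left[symmetric] by (simp add: divide_simps mult.commute)
next
  fix v assume v: "v \<in> U"
  have "0 \<le> r\<^sup>2 / (1 + r\<^sup>2) * w v" using w_pos U(1) v by (intro mult_nonneg_nonneg) (auto intro: less_imp_le)
  moreover have "1 \<le> real (degree U v)" using deg[OF v] by simp
  ultimately have "1 * (r\<^sup>2 / (1 + r\<^sup>2) * w v) \<le> real (degree U v) * (r\<^sup>2 / (1 + r\<^sup>2) * w v)"
    by (intro mult_right_mono)
  then show "r\<^sup>2 / (1 + r\<^sup>2) * w v \<le> real (degree U v) * (r\<^sup>2 / (1 + r\<^sup>2) * w v)"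
    by (simp only: mult_1)
qed

text \<open>
  A pair gives its end of degree 1, if there is one, the fraction 2x / (2 + x) of the weight of
  that end, where x = r^2, and half of this to the other end, which gets such a half at least twice.
\<close>

lemma slack_paths:
  assumes U: "U \<subseteq> S" "card U \<le> s" and deg: "\<And>v. v \<in> U \<Longrightarrow> 0 < degree U v"
    and no_isolated: "\<And>p. p \<in> pairs U \<Longrightarrow> 2 \<le> degree U (apex (fst p)) \<or> 2 \<le> degree U (snd p)"
  shows "2 * r\<^sup>2 / (2 + r\<^sup>2) * weight w U \<le> (\<Sum>b\<in>U. slack b)"
proof -
  define x where "x = r\<^sup>2"
  have x: "0 < x" "x \<le> 1" unfolding x_def using r_pos r2_le_1 by auto
  define h where "h = x / (2 + x)"
  have h: "0 < h" "h * (2 + x) = x" unfolding h_def using x by auto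
  define f where "f v = (if degree U v = 1 then 2 * h * w v else h * w v)" for v
  have "2 * h * weight w U \<le> (\<Sum>b\<in>U. slack b)"
  proof (rule slack_by_pairs[OF U, where f = f])
    fix p assume p: "p \<in> pairs U"
    define a b where ab: "a = w (apex (fst p))" "b = w (snd p)"
    have le: "b \<le> a" "x * a \<le> b" using pairs_props(6,7)[OF p] unfolding ab x_def by auto
    have "0 < a" "0 < b" using pairs_props(2,3)[OF p] U(1) w_pos unfolding ab by auto
    \<comment> \<open>The apex is the end of degree 1; equality holds for
      \<open>b = x * a\<close>.\<close>
    have 1: "2 * h * a + h * b \<le> b"
    proof -
      have "(2 * h * a + h * b) * (2 + x) = 2 * (h * (2 + x)) * a + (h * (2 + x)) * b"
        by (simp add: algebra_simps)
      also have "\<dots> \<le> b * (2 + x)" using le unfolding h(2) by (simp add: algebra_simps)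
      finally show ?thesis using x by (simp add: mult_le_cancel_right)
    qed
    \<comment> \<open>The lighter end has degree 1; here \<open>x \<le> 1\<close> enters as
      well.\<close>
    have 2: "h * a + 2 * h * b \<le> b"
    proof -
      have "(h * a + 2 * h * b) * (2 + x) = (h * (2 + x)) * a + 2 * (h * (2 + x)) * b"
        by (simp add: algebra_simps)
      also have "\<dots> \<le> b * (2 + x)"
      proof -
        have "x * b \<le> 1 * b" using x \<open>0 < b\<close> by (intro mult_right_mono) auto
        then show ?thesis using le unfolding h(2) by (simp add: algebra_simps)
      qed
      finally show ?thesis using x by (simp add: mult_le_cancel_right)
    qed
    have "h * a \<le> 2 * h * a" "h * b \<le> 2 * h * b" using h(1) \<open>0 < a\<close> \<open>0 < b\<close> by auto
    with 1 2 no_isolated[OF p] show "f (apex (fst p)) + f (snd p) \<le> w (snd p)"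
      unfolding f_def ab by auto
  next
    fix v assume v: "v \<in> U"
    have "0 < w v" using v U w_pos by auto
    show "2 * h * w v \<le> real (degree U v) * f v"
    proof (cases "degree U v = 1")
      case False
      then have "2 \<le> real (degree U v)" using deg[OF v] by linarith
      then have "2 * (h * w v) \<le> real (degree U v) * (h * w v)"
        using h(1) \<open>0 < w v\<close> by (intro mult_right_mono) auto
      then show ?thesis using False unfolding f_def by (simp add: mult.assoc)
    qed (simp add: f_def)
  qed
  then show ?thesis unfolding h_def x_def by simp
qed

section \<open>Shares of components\<close>

lemma heavy_closed:
  assumes "adj `` K \<subseteq> K" "q \<in> cluster K"
  shows "heavy q \<subseteq> K"
proof
  fix b assume b: "b \<in> heavy q"
  have q: "q \<in> Q" "apex q \<in> K" using assms(2) unfolding cluster_def by auto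
  show "b \<in> K"
  proof (cases "b = apex q")
    case False
    then have "(apex q, b) \<in> adj" unfolding adj_def using b q by auto
    with assms(1) q show ?thesis by auto
  qed (use q in simp)
qed

text \<open>Lowering the rate for heavy neighbours from 1 to \<open>r\<close> only moves money to
  the apex, and both lie in the closed set \<open>K\<close>. The payments at rate 1 amount to at
  most \<open>k\<close> times the weight of \<open>K\<close>.\<close>

lemma sum_share_le:
  assumes K: "K \<subseteq> S" "adj `` K \<subseteq> K"
  shows "(\<Sum>b\<in>K. share b) \<le> (real k + 1) * weight w K - (\<Sum>b\<in>K. slack b)"
proof -
  have fin: "finite K" using finite_subset[OF K(1) finite_S] .
  let ?c = "\<lambda>b. real (card {q \<in> Q. b \<in> N q})"
  have "(\<Sum>q\<in>cluster K. weight w (heavy q))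
    = (\<Sum>q\<in>cluster K. \<Sum>b\<in>K. if b \<in> heavy q then w b else 0)"
  proof (rule sum.cong)
    fix q assume "q \<in> cluster K"
    then have "K \<inter> heavy q = heavy q" using heavy_closed[OF K(2)] by auto
    then show "weight w (heavy q) = (\<Sum>b\<in>K. if b \<in> heavy q then w b else 0)"
      unfolding weight_def using fin by (simp add: sum.inter_restrict[symmetric])
  qed simp
  also have "\<dots> = (\<Sum>b\<in>K. \<Sum>q\<in>cluster K. if b \<in> heavy q then w b else 0)" by (rule sum.swap)
  also have "\<dots> \<le> (\<Sum>b\<in>K. ?c b * w b)"
  proof (rule sum_mono)
    fix b assume "b \<in> K"
    then have "0 < w b" using K w_pos by auto
    have "card {q \<in> cluster K. b \<in> heavy q} \<le> card {q \<in> Q. b \<in> N q}"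
      using finite_Q heavy_props(2) by (intro card_mono) (auto simp: cluster_def)
    then have "real (card {q \<in> cluster K. b \<in> heavy q}) * w b \<le> ?c b * w b"
      using \<open>0 < w b\<close> by simp
    then show "(\<Sum>q\<in>cluster K. if b \<in> heavy q then w b else 0) \<le> ?c b * w b"
      using finite_cluster by (simp add: sum.If_cases Int_def)
  qed
  finally have heavy_sum: "(\<Sum>q\<in>cluster K. weight w (heavy q)) \<le> (\<Sum>b\<in>K. ?c b * w b)" .
  have "(\<Sum>b\<in>K. share b) = r * (\<Sum>b\<in>K. ?c b * w b)
      + (\<Sum>q\<in>cluster K. 2 * w q - r * weight w (N q))"
    unfolding share_def sum.distrib sum_cluster[OF fin] sum_distrib_left by (simp add: mult_ac)
  \<comment> \<open>The apex of \<open>q\<close> gains \<open>(1 - r) * weight w (heavy q)\<close>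
    over \<open>charge q\<close>.\<close>
  also have "(\<Sum>q\<in>cluster K. 2 * w q - r * weight w (N q))
    = (\<Sum>q\<in>cluster K. charge q + (1 - r) * weight w (heavy q))"
    by (intro sum.cong) (auto simp: charge_def cluster_def weight_N algebra_simps)
  also have "\<dots> = (\<Sum>q\<in>cluster K. charge q) + (1 - r) * (\<Sum>q\<in>cluster K. weight w (heavy q))"
    by (simp add: sum.distrib sum_distrib_left)
  also have "(\<Sum>q\<in>cluster K. charge q) = weight w K - (\<Sum>b\<in>K. slack b)"
    unfolding slack_def weight_def sum_subtractf sum_cluster[OF fin] by simp
  also have "(1 - r) * (\<Sum>q\<in>cluster K. weight w (heavy q)) \<le> (1 - r) * (\<Sum>b\<in>K. ?c b * w b)"
    using heavy_sum r_le_1 by (intro mult_left_mono) auto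
  finally have "(\<Sum>b\<in>K. share b) \<le> (\<Sum>b\<in>K. ?c b * w b) + weight w K - (\<Sum>b\<in>K. slack b)"
    by (simp add: algebra_simps)
  also have "(\<Sum>b\<in>K. ?c b * w b) \<le> real k * weight w K"
    unfolding weight_def sum_distrib_left
  proof (rule sum_mono)
    fix b assume "b \<in> K"
    then have b: "b \<in> S" using K by auto
    then have "0 < w b" using w_pos by auto
    then show "?c b * w b \<le> real k * w b"
      using card_N_inv[OF b] by simp
  qed
  finally show ?thesis by (simp add: algebra_simps)
qed

text \<open>By \<open>linked_sum_nonneg\<close> with \<open>d = k * (k - 1)\<close> only linked
  pieces with at most \<open>m * d + 1\<close> elements matter, and \<open>s\<close> admits
  exchanges of that size.\<close>

lemma share_large_component:
  assumes K: "K \<subseteq> S" "adj `` K \<subseteq> K" "linked adj K" "m < card K"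
    and s: "m * (k * (k - 1)) + 1 \<le> s"
    and base: "\<And>U. U \<subseteq> S \<Longrightarrow> card U \<le> s \<Longrightarrow> linked adj U \<Longrightarrow> m < card U \<Longrightarrow>
      \<rho> * weight w U \<le> (\<Sum>b\<in>U. slack b)"
  shows "(\<Sum>b\<in>K. share b) \<le> (real k + 1 - \<rho>) * weight w K"
proof -
  have "0 \<le> (\<Sum>b\<in>K. slack b - \<rho> * w b)"
  proof (rule linked_sum_nonneg[OF sym_adj finite_S adj_degree(2) adj_degree(1) _ K(1,3,4)])
    fix U assume "U \<subseteq> S" "linked adj U" "m < card U" "card U \<le> m * (k * (k - 1)) + 1"
    with s base[of U] have "\<rho> * weight w U \<le> (\<Sum>b\<in>U. slack b)" by simp
    then show "0 \<le> (\<Sum>b\<in>U. slack b - \<rho> * w b)"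
      by (simp add: sum_subtractf weight_def sum_distrib_left)
  qed
  then have "\<rho> * weight w K \<le> (\<Sum>b\<in>K. slack b)"
    by (simp add: sum_subtractf weight_def sum_distrib_left)
  with sum_share_le[OF K(1,2)] show ?thesis by (simp add: algebra_simps)
qed

lemma discounted_share:
  assumes "q \<in> Q" "heavy q = {a}"
  shows "2 * w q - r * weight w (N q) = 2 * w q - r * w a - r * weight w (light q)"
  unfolding weight_N[OF assms(1)] assms(2) by (simp add: weight_def distrib_left)

lemma share_le_count:
  assumes "a \<in> S"
  shows "share a \<le> r * real k * w a + (\<Sum>q\<in>cluster {a}. 2 * w q - r * weight w (N q))"
proof -
  have "r * w a * real (card {q \<in> Q. a \<in> N q}) \<le> r * w a * real k"
    using r_pos w_pos[of a] assms card_N_inv by (intro mult_left_mono) auto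
  then show ?thesis unfolding share_def by (simp add: mult_ac)
qed

text \<open>Every \<open>q\<close> with apex \<open>a\<close> has no other heavy neighbour, so
  \<open>gain_discounted\<close> applies to the exchange for \<open>{a}\<close>. Division by
  \<open>r * w a\<close> bounds the remainders by \<open>w a / r\<close>; direct payments add at
  most \<open>r * k * w a\<close>.\<close>

lemma share_singleton:
  assumes a: "a \<in> S" "adj `` {a} \<subseteq> {a}" and s: "1 \<le> s"
  shows "share a \<le> (r * real k + 1 / r) * w a"
proof -
  have wa: "0 < w a" using a w_pos by auto
  have heavy: "heavy q = {a}" "apex q = a" "q \<in> Q" if "q \<in> cluster {a}" for q
  proof -
    show q: "q \<in> Q" "apex q = a" using that unfolding cluster_def by auto
    show "heavy q = {a}" using heavy_closed[OF a(2) that] heavy_props(5)[OF q(1)] q(2) by auto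
  qed
  have "r * w a * (\<Sum>q\<in>cluster {a}. 2 * w q - r * weight w (N q))
    \<le> (\<Sum>q\<in>cluster {a}. (w q)\<^sup>2 - sq_weight w (N q - {a}))"
    unfolding sum_distrib_left
  proof (rule sum_mono)
    fix q assume q: "q \<in> cluster {a}"
    show "r * w a * (2 * w q - r * weight w (N q)) \<le> (w q)\<^sup>2 - sq_weight w (N q - {a})"
      using gain_discounted[OF q] heavy[OF q] unfolding discounted_share[OF heavy(3,1)[OF q]] by simp
  qed
  also have "\<dots> \<le> w a * w a"
    using exchange[of "{a}"] a s by (simp add: sq_weight_def power2_eq_square)
  finally have "r * (\<Sum>q\<in>cluster {a}. 2 * w q - r * weight w (N q)) \<le> w a"
    using wa by (simp add: mult.commute mult.left_commute)
  then have "(\<Sum>q\<in>cluster {a}. 2 * w q - r * weight w (N q)) \<le> w a / r"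
    using r_pos by (simp add: pos_le_divide_eq mult.commute)
  with share_le_count[OF a(1)] show ?thesis by (simp add: algebra_simps)
qed

text \<open>Such components escape the long exchanges: a single edge only gives x/(1+x).\<close>

lemma share_pair:
  assumes K: "{a, b} \<subseteq> S" "a \<noteq> b" "adj `` {a, b} \<subseteq> {a, b}" and s: "2 \<le> s"
    and single: "pairs {a, b} = {(q\<^sub>0, b)}"
  shows "share a + share b \<le> (r * real k + 1 / r) * (w a + w b)"
proof -
  have p0: "(q\<^sub>0, b) \<in> pairs {a, b}" using single by simp
  note pp = pairs_props[OF p0, simplified]
  have a0: "apex q\<^sub>0 = a" using pp(2,4) by auto
  have wa: "0 < w a" "0 < w b" using K w_pos by auto
  have ba: "w b \<le> w a" using pp(6) a0 by simp
  have q0: "q\<^sub>0 \<in> cluster {a}" "q\<^sub>0 \<in> cluster {a, b}" "q\<^sub>0 \<notin> cluster {b}"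
    using pp(1) a0 K(2) unfolding cluster_def by auto
  \<comment> \<open>Only \<open>q\<^sub>0\<close> has a second heavy neighbour in the
    component.\<close>
  have sing: "heavy q = {apex q}" if "q \<in> cluster {a, b}" "q \<noteq> q\<^sub>0" for q
  proof -
    have "heavy q \<inter> {a, b} - {apex q} = {}" using single that unfolding pairs_def by auto
    moreover have "heavy q \<subseteq> {a, b}" by (rule heavy_closed[OF K(3) that(1)])
    moreover have "apex q \<in> heavy q" using that heavy_props(5) unfolding cluster_def by auto
    ultimately show ?thesis by auto
  qed
  let ?z = "\<lambda>q. 2 * w q - r * weight w (N q)"
  let ?g = "\<lambda>U q. (w q)\<^sup>2 - sq_weight w (N q - U)"
  have piece: "r * w c * ?z q \<le> ?g U q"
    if "q \<in> cluster {c}" "q \<noteq> q\<^sub>0" "c \<in> U" "U \<subseteq> {a, b}" for q c U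
  proof -
    have q: "q \<in> Q" "apex q = c" "q \<in> cluster U" "q \<in> cluster {a, b}"
      using that unfolding cluster_def by auto
    have h: "heavy q = {c}" using sing[OF q(4) that(2)] q(2) by simp
    show ?thesis
      unfolding discounted_share[OF q(1) h] using gain_discounted[OF q(3)] h that(3) q(2) by simp
  qed
  define P\<^sub>a where "P\<^sub>a = (\<Sum>q\<in>cluster {a} - {q\<^sub>0}. ?z q)"
  define P\<^sub>b where "P\<^sub>b = (\<Sum>q\<in>cluster {b}. ?z q)"
  \<comment> \<open>This is the remainder of \<open>q\<^sub>0\<close> before it pays
    \<open>b\<close>, since \<open>b\<close> costs nothing in the exchange for
    \<open>{a, b}\<close>.\<close>
  define Z where "Z = 2 * w q\<^sub>0 - r * w a - r * weight w (light q\<^sub>0)"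
  have b_bound: "r * w b * P\<^sub>b \<le> (w b)\<^sup>2"
  proof -
    have "r * w b * P\<^sub>b \<le> (\<Sum>q\<in>cluster {b}. ?g {b} q)"
      unfolding P\<^sub>b_def sum_distrib_left using q0(3) by (intro sum_mono piece) auto
    also have "\<dots> \<le> (w b)\<^sup>2" using exchange[of "{b}"] K s by (simp add: sq_weight_def)
    finally show ?thesis .
  qed
  have ab_bound: "r * w a * (Z + P\<^sub>a) + r * w b * P\<^sub>b \<le> (w a)\<^sup>2 + (w b)\<^sup>2"
  proof -
    have "cluster {a, b} = insert q\<^sub>0 ((cluster {a} - {q\<^sub>0}) \<union> cluster {b})"
      using q0 unfolding cluster_def by auto
    then have "(\<Sum>q\<in>cluster {a, b}. ?g {a, b} q)
      = (\<Sum>q\<in>insert q\<^sub>0 ((cluster {a} - {q\<^sub>0}) \<union> cluster {b}). ?g {a, b} q)" by simp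
    also have "\<dots> = ?g {a, b} q\<^sub>0 + (\<Sum>q\<in>(cluster {a} - {q\<^sub>0}) \<union> cluster {b}. ?g {a, b} q)"
      using finite_cluster q0(3) by (subst sum.insert) auto
    also have "(\<Sum>q\<in>(cluster {a} - {q\<^sub>0}) \<union> cluster {b}. ?g {a, b} q)
      = (\<Sum>q\<in>cluster {a} - {q\<^sub>0}. ?g {a, b} q) + (\<Sum>q\<in>cluster {b}. ?g {a, b} q)"
      using K(2) by (intro sum.union_disjoint finite_Diff finite_cluster) (auto simp: cluster_def)
    finally have eq: "(\<Sum>q\<in>cluster {a, b}. ?g {a, b} q) = ?g {a, b} q\<^sub>0
      + ((\<Sum>q\<in>cluster {a} - {q\<^sub>0}. ?g {a, b} q) + (\<Sum>q\<in>cluster {b}. ?g {a, b} q))" .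
    have "r * w a * P\<^sub>a \<le> (\<Sum>q\<in>cluster {a} - {q\<^sub>0}. ?g {a, b} q)"
      unfolding P\<^sub>a_def sum_distrib_left by (intro sum_mono piece) auto
    moreover have "r * w b * P\<^sub>b \<le> (\<Sum>q\<in>cluster {b}. ?g {a, b} q)"
      unfolding P\<^sub>b_def sum_distrib_left using q0(3) by (intro sum_mono piece) auto
    moreover have "r * w a * Z \<le> ?g {a, b} q\<^sub>0"
      using gain_discounted[OF q0(2) heavy_closed[OF K(3) q0(2)]] a0 unfolding Z_def by simp
    moreover have "(\<Sum>q\<in>cluster {a, b}. ?g {a, b} q) \<le> (w a)\<^sup>2 + (w b)\<^sup>2"
      using exchange[of "{a, b}"] K s by (simp add: sq_weight_def)
    ultimately show ?thesis unfolding eq by (simp add: distrib_left)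
  qed
  \<comment> \<open>Abel summation for two elements: adding \<open>w a - w b\<close> times the bound
    for \<open>b\<close> gives all terms the common factor \<open>w a\<close>.\<close>
  have "(w a - w b) * (r * P\<^sub>b) \<le> (w a - w b) * w b"
  proof (rule mult_left_mono)
    have "w b * (r * P\<^sub>b) \<le> w b * w b" using b_bound by (simp add: power2_eq_square mult_ac)
    then show "r * P\<^sub>b \<le> w b" using wa by simp
  qed (use ba in simp)
  with ab_bound have "w a * (r * (Z + P\<^sub>a + P\<^sub>b)) \<le> w a * (w a + w b)"
    by (simp add: algebra_simps power2_eq_square)
  then have "r * (Z + P\<^sub>a + P\<^sub>b) \<le> w a + w b" using wa by simp
  then have main: "Z + P\<^sub>a + P\<^sub>b \<le> (w a + w b) / r"
    using r_pos by (simp add: pos_le_divide_eq mult.commute)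
  have "?z q\<^sub>0 \<le> Z"
  proof -
    have "heavy q\<^sub>0 = {a, b}"
      using heavy_closed[OF K(3) q0(2)] pp(5) heavy_props(5)[OF pp(1)] a0 by auto
    then have "?z q\<^sub>0 = Z - r * w b"
      using weight_N[OF pp(1)] K(2) unfolding Z_def by (simp add: weight_def algebra_simps)
    then show ?thesis using r_pos wa by simp
  qed
  moreover have "(\<Sum>q\<in>cluster {a}. ?z q) = ?z q\<^sub>0 + P\<^sub>a"
    unfolding P\<^sub>a_def by (rule sum.remove[OF finite_cluster q0(1)])
  ultimately show ?thesis
    using main share_le_count[of a] share_le_count[of b] K(1)
    unfolding P\<^sub>b_def by (simp add: algebra_simps add_divide_distrib)
qed

text \<open>What \<open>q\<close> pays to its neighbours is subtracted again at its apex, so twice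
  the weight of each \<open>q\<close> is distributed exactly once.\<close>

lemma sum_share: "(\<Sum>b\<in>S. share b) = 2 * weight w Q"
proof -
  have cl: "cluster S = Q" unfolding cluster_def using apex_in_S by auto
  have "(\<Sum>q\<in>Q. weight w (N q)) = (\<Sum>q\<in>Q. \<Sum>b\<in>S. if b \<in> N q then w b else 0)"
  proof (rule sum.cong)
    fix q assume "q \<in> Q"
    then have "S \<inter> N q = N q" using N_subset by auto
    then show "weight w (N q) = (\<Sum>b\<in>S. if b \<in> N q then w b else 0)"
      unfolding weight_def using finite_S by (simp add: sum.inter_restrict[symmetric])
  qed simp
  also have "\<dots> = (\<Sum>b\<in>S. \<Sum>q\<in>Q. if b \<in> N q then w b else 0)" by (rule sum.swap)
  also have "\<dots> = (\<Sum>b\<in>S. w b * card {q \<in> Q. b \<in> N q})"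
    using finite_Q by (simp add: sum.If_cases Int_def mult.commute)
  finally have "(\<Sum>q\<in>Q. weight w (N q)) = (\<Sum>b\<in>S. w b * card {q \<in> Q. b \<in> N q})" .
  then show ?thesis
    unfolding share_def sum.distrib sum_cluster[OF finite_S] cl
    by (simp add: sum_subtractf sum_distrib_left[symmetric] mult.assoc weight_def)
qed

lemma weight_bound_by_components:
  assumes "\<And>K. K \<subseteq> S \<Longrightarrow> K \<noteq> {} \<Longrightarrow> linked adj K \<Longrightarrow> adj `` K \<subseteq> K \<Longrightarrow>
    (\<Sum>b\<in>K. share b) \<le> c * weight w K"
  shows "2 * weight w Q \<le> c * weight w S"
proof -
  have "0 \<le> (\<Sum>b\<in>S. c * w b - share b)"
  proof (rule closed_sum_nonneg[OF sym_adj finite_S])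
    fix K assume "K \<subseteq> S" "K \<noteq> {}" "linked adj K" "adj `` K \<subseteq> K"
    from assms[OF this] show "0 \<le> (\<Sum>b\<in>K. c * w b - share b)"
      by (simp add: sum_subtractf weight_def sum_distrib_left)
  next
    show "adj `` S \<subseteq> S" unfolding adj_def using heavy_props(1) apex_in_S by auto
  qed simp
  then show ?thesis using sum_share by (simp add: sum_subtractf weight_def sum_distrib_left)
qed

text \<open>The second term of the minimum is the amount by which the factor
  \<open>r * k + 1 / r\<close> of small components falls short of \<open>k + 1\<close>.\<close>

lemma discount_eq: "(real k - 1 / r) * (1 - r) = real k + 1 - (r * real k + 1 / r)"
proof -
  have "1 / r * r = 1" using r_pos by simp
  then show ?thesis by (simp add: left_diff_distrib right_diff_distrib)
qed

section \<open>The weight bounds for the two exchange sizes\<close>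

theorem weight_bound_short:
  assumes s: "k * (k - 1) + 1 \<le> s"
    and t: "t \<le> r\<^sup>2 / (1 + r\<^sup>2)" "t \<le> (real k - 1 / r) * (1 - r)"
  shows "2 * weight w Q \<le> (real k + 1 - t) * weight w S"
proof (rule weight_bound_by_components)
  fix K assume K: "K \<subseteq> S" "K \<noteq> {}" "linked adj K" "adj `` K \<subseteq> K"
  have fin: "finite K" using finite_subset[OF K(1) finite_S] .
  note wK = weight_nonneg[OF K(1)]
  have "0 < card K" using K(2) fin by (simp add: card_gt_0_iff)
  then consider "card K = 1" | "1 < card K" by linarith
  then show "(\<Sum>b\<in>K. share b) \<le> (real k + 1 - t) * weight w K"
  proof cases
    case 1
    then obtain a where a: "K = {a}" by (rule card_1_singletonE)
    have "share a \<le> (r * real k + 1 / r) * w a" using K s unfolding a by (intro share_singleton) auto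
    also have "\<dots> \<le> (real k + 1 - t) * w a"
      using t(2) wK unfolding discount_eq a by (intro mult_right_mono) (auto simp: weight_def)
    finally show ?thesis unfolding a by (simp add: weight_def)
  next
    case 2
    have "(\<Sum>b\<in>K. share b) \<le> (real k + 1 - r\<^sup>2 / (1 + r\<^sup>2)) * weight w K"
      using s by (intro share_large_component[OF K(1,4,3) 2] slack_edges linked_degree_pos) auto
    also have "\<dots> \<le> (real k + 1 - t) * weight w K" using t(1) wK by (intro mult_right_mono) auto
    finally show ?thesis .
  qed
qed

theorem weight_bound_long:
  assumes s: "2 * (k * (k - 1)) + 1 \<le> s"
    and t: "t \<le> 2 * r\<^sup>2 / (2 + r\<^sup>2)" "t \<le> (real k - 1 / r) * (1 - r)"
  shows "2 * weight w Q \<le> (real k + 1 - t) * weight w S"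
proof (rule weight_bound_by_components)
  fix K assume K: "K \<subseteq> S" "K \<noteq> {}" "linked adj K" "adj `` K \<subseteq> K"
  have fin: "finite K" using finite_subset[OF K(1) finite_S] .
  note wK = weight_nonneg[OF K(1)]
  have path: "(real k + 1 - 2 * r\<^sup>2 / (2 + r\<^sup>2)) * weight w K \<le> (real k + 1 - t) * weight w K"
    using t(1) wK by (intro mult_right_mono) auto
  have disc: "(r * real k + 1 / r) * weight w K \<le> (real k + 1 - t) * weight w K"
    using t(2) wK unfolding discount_eq by (intro mult_right_mono) auto
  have "0 < card K" using K(2) fin by (simp add: card_gt_0_iff)
  then consider "card K = 1" | "card K = 2" | "2 < card K" by linarith
  then show "(\<Sum>b\<in>K. share b) \<le> (real k + 1 - t) * weight w K"
  proof cases
    case 1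
    then obtain a where a: "K = {a}" by (rule card_1_singletonE)
    have "share a \<le> (r * real k + 1 / r) * w a" using K s unfolding a by (intro share_singleton) auto
    with disc show ?thesis unfolding a by (simp add: weight_def)
  next
    case 2
    obtain v where v: "v \<in> K" using K(2) by auto
    have deg: "0 < degree K v" if "v \<in> K" for v using linked_degree_pos[OF K(3)] 2 that by simp
    obtain p where p: "p \<in> pairs K"
      using deg[OF v] unfolding degree_def by (metis (no_types, lifting) card.empty empty_Collect_eq less_irrefl)
    define q\<^sub>0 where "q\<^sub>0 = fst p"
    define a where "a = apex q\<^sub>0"
    define b where "b = snd p"
    note pp = pairs_props[OF p, folded q\<^sub>0_def b_def, folded a_def]
    have Kab: "K = {a, b}"
      using card_subset_eq[OF fin, of "{a, b}"] pp(2,3,4) 2 by auto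
    \<comment> \<open>Two elements in one \<open>N q\<^sub>0\<close> force \<open>k \<ge> 2\<close>,
      hence \<open>s \<ge> 2\<close>, so both elements of \<open>K\<close> may be treated in one
      exchange.\<close>
    have "card {a, b} \<le> card (N q\<^sub>0)"
      using pp(1,5) apex_in_N heavy_props(2) finite_N unfolding a_def by (intro card_mono) auto
    then have "2 \<le> k" using card_N[OF pp(1)] pp(4) by simp
    then have "2 * 1 \<le> k * (k - 1)" by (intro mult_le_mono) auto
    then have s2: "2 \<le> s" using s by simp
    show ?thesis
    proof (cases "pairs K = {p}")
      case True
      have "share a + share b \<le> (r * real k + 1 / r) * (w a + w b)"
        using K pp(4) s2 True unfolding Kab q\<^sub>0_def b_def by (intro share_pair[where q\<^sub>0 = q\<^sub>0]) (auto simp: q\<^sub>0_def b_def)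
      with disc show ?thesis unfolding Kab using pp(4) by (simp add: weight_def)
    next
      case False
      then obtain p' where p': "p' \<in> pairs K" "p' \<noteq> p" using p by auto
      \<comment> \<open>The parallel edges \<open>p\<close> and \<open>p'\<close> both join
        \<open>a\<close> and \<open>b\<close>, so the path bound applies despite only two
        vertices.\<close>
      have "2 \<le> degree K v" if "v \<in> K" for v
      proof (rule degree_ge_2[OF p _ p'(1) _ p'(2)[symmetric]])
        show "v = apex (fst p) \<or> v = snd p"
          using that unfolding Kab a_def b_def q\<^sub>0_def by auto
        show "v = apex (fst p') \<or> v = snd p'"
          using that pairs_props(2,3,4)[OF p'(1)] unfolding Kab by auto
      qed
      then have "2 * r\<^sup>2 / (2 + r\<^sup>2) * weight w K \<le> (\<Sum>b\<in>K. slack b)"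
        using K(1) 2 s2 deg pairs_props(2) by (intro slack_paths) auto
      with sum_share_le[OF K(1,4)] path show ?thesis by (simp add: algebra_simps)
    qed
  next
    case 3
    have "(\<Sum>b\<in>K. share b) \<le> (real k + 1 - 2 * r\<^sup>2 / (2 + r\<^sup>2)) * weight w K"
      using s by (intro share_large_component[OF K(1,4,3) 3] slack_paths linked_degree_pos
          linked_no_isolated_pair) auto
    with path show ?thesis by simp
  qed
qed

end

subsection \<open>The maxima over the discount\<close>

lemma sqrt_discount:
  assumes "e \<in> {0..1/2}"
  shows "0 < sqrt (1 - e)" "sqrt (1 - e) \<le> 1" "(sqrt (1 - e))\<^sup>2 = 1 - e"
  using assms by auto

text \<open>A maximizer for \<open>i\<close> is tried for \<open>j\<close>: only the factor in front
  of \<open>1 - sqrt (1 - e)\<close>, which is nonnegative, grows.\<close>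

lemma mono_on_tau1: "mono_on {1..} tau1"
proof (rule mono_onI)
  fix i j :: nat assume "i \<le> j"
  obtain e where e: "e \<in> {0..1/2}" "tau1 i = tau1_objective i e" using tau1_attained by blast
  have "tau1_objective i e \<le> tau1_objective j e"
    using e(1) \<open>i \<le> j\<close> unfolding tau1_objective_def
    by (intro min.mono mult_right_mono) auto
  also have "\<dots> \<le> tau1 j" by (rule tau1_upper[OF e(1)])
  finally show "tau1 i \<le> tau1 j" using e(2) by simp
qed

lemma mono_on_tau2: "mono_on {1..} tau2"
proof (rule mono_onI)
  fix i j :: nat assume "i \<le> j"
  obtain e where e: "e \<in> {0..1/2}" "tau2 i = tau2_objective i e" using tau2_attained by blast
  have "tau2_objective i e \<le> tau2_objective j e"
    using e(1) \<open>i \<le> j\<close> unfolding tau2_objective_def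
    by (intro min.mono mult_right_mono order_refl) auto
  also have "\<dots> \<le> tau2 j" by (rule tau2_upper[OF e(1)])
  finally show "tau2 i \<le> tau2 j" using e(2) by simp
qed

text \<open>The choice e = 4/k makes all but the first term of the minima at least 2/3.\<close>

lemma objective_terms:
  assumes "16 \<le> k"
  defines "e \<equiv> 4 / real k"
  shows "e \<in> {0..1/2}" "2/3 \<le> (real k - 1 / sqrt (1 - e)) * (1 - sqrt (1 - e))"
    "2/3 \<le> 2 - 1 / sqrt (1 - e)"
proof -
  have k: "16 \<le> real k" using assms(1) by simp
  have e: "0 < e" "e \<le> 1/4" "e * real k = 4" unfolding e_def using k by (auto simp: divide_simps)
  then show "e \<in> {0..1/2}" by auto
  define r where "r = sqrt (1 - e)"
  have r2: "r\<^sup>2 = 1 - e" and r1: "r \<le> 1" and r0: "0 < r" unfolding r_def using e by auto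
  have r34: "3/4 \<le> r" unfolding r_def using e by (intro real_le_rsqrt) (auto simp: power2_eq_square)
  then have inv: "1 / r \<le> 4/3" by (simp add: divide_simps)
  have "(1 - r) * (1 + r) = e" using r2 by (simp add: algebra_simps power2_eq_square)
  moreover have "(1 - r) * (1 + r) \<le> (1 - r) * 2" using r1 by (intro mult_left_mono) auto
  ultimately have half: "e / 2 \<le> 1 - r" by simp
  \<comment> \<open>As \<open>e * k = 4\<close>, the product is \<open>2 - 2 * e / 3\<close>, and
    \<open>e \<le> 1/4\<close>.\<close>
  have "2/3 \<le> (real k - 4/3) * (e / 2)" using e by (simp add: algebra_simps)
  also have "\<dots> \<le> (real k - 1 / r) * (1 - r)"
    using inv half k e(1) by (intro mult_mono) auto
  finally show "2/3 \<le> (real k - 1 / sqrt (1 - e)) * (1 - sqrt (1 - e))" unfolding r_def .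
  show "2/3 \<le> 2 - 1 / sqrt (1 - e)" using inv unfolding r_def by simp
qed

text \<open>The first term never exceeds 1/2. At \<open>e = 4/k\<close> it is the minimum, since it
  stays below 2/3 and the other term does not, and it tends to 1/2.\<close>

lemma tau1_limit: "tau1 \<longlonglongrightarrow> 1/2"
proof (rule tendsto_sandwich)
  show "\<forall>\<^sub>F k in sequentially. tau1 k \<le> 1/2"
  proof (rule always_eventually, rule allI)
    fix k
    obtain e where e: "e \<in> {0..1/2}" "tau1 k = tau1_objective k e" using tau1_attained by blast
    have "tau1 k \<le> (1 - e) / (2 - e)" unfolding e(2) tau1_objective_def by simp
    also have "\<dots> \<le> 1/2" using e(1) by (auto simp: divide_simps)
    finally show "tau1 k \<le> 1/2" .
  qed
  show "\<forall>\<^sub>F k in sequentially. (1 - 4 / real k) / (2 - 4 / real k) \<le> tau1 k"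
    using eventually_ge_at_top[of 16]
  proof eventually_elim
    case (elim k)
    note t = objective_terms[OF elim]
    have le: "(1 - 4 / real k) / (2 - 4 / real k) \<le> 2/3" using elim by (simp add: divide_simps)
    have "(1 - 4 / real k) / (2 - 4 / real k) \<le> tau1_objective k (4 / real k)"
      unfolding tau1_objective_def by (intro min.boundedI order_refl order_trans[OF le t(2)])
    also have "\<dots> \<le> tau1 k" by (rule tau1_upper[OF t(1)])
    finally show ?case .
  qed
  have "(\<lambda>k. (1 - 4 / real k) / (2 - 4 / real k)) \<longlonglongrightarrow> (1 - 0) / (2 - 0)"
    by (intro tendsto_intros lim_const_over_n) simp
  then show "(\<lambda>k. (1 - 4 / real k) / (2 - 4 / real k)) \<longlonglongrightarrow> 1/2" by simp
qed simp

lemma tau2_limit: "tau2 \<longlonglongrightarrow> 2/3"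
proof (rule tendsto_sandwich)
  show "\<forall>\<^sub>F k in sequentially. tau2 k \<le> 2/3"
  proof (rule always_eventually, rule allI)
    fix k
    obtain e where e: "e \<in> {0..1/2}" "tau2 k = tau2_objective k e" using tau2_attained by blast
    have "tau2 k \<le> 2 * (1 - e) / (3 - e)" unfolding e(2) tau2_objective_def by simp
    also have "\<dots> \<le> 2/3" using e(1) by (auto simp: divide_simps)
    finally show "tau2 k \<le> 2/3" .
  qed
  show "\<forall>\<^sub>F k in sequentially. 2 * (1 - 4 / real k) / (3 - 4 / real k) \<le> tau2 k"
    using eventually_ge_at_top[of 16]
  proof eventually_elim
    case (elim k)
    note t = objective_terms[OF elim]
    have le: "2 * (1 - 4 / real k) / (3 - 4 / real k) \<le> 2/3" using elim by (simp add: divide_simps)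
    have "2 * (1 - 4 / real k) / (3 - 4 / real k) \<le> tau2_objective k (4 / real k)"
      unfolding tau2_objective_def
      by (intro min.boundedI order_refl order_trans[OF le t(2)] order_trans[OF le t(3)])
    also have "\<dots> \<le> tau2 k" by (rule tau2_upper[OF t(1)])
    finally show ?case .
  qed
  have "(\<lambda>k. 2 * (1 - 4 / real k) / (3 - 4 / real k)) \<longlonglongrightarrow> 2 * (1 - 0) / (3 - 0)"
    by (intro tendsto_intros lim_const_over_n) simp
  then show "(\<lambda>k. 2 * (1 - 4 / real k) / (3 - 4 / real k)) \<longlonglongrightarrow> 2/3" by simp
qed simp

subsection \<open>Outputs of the local search\<close>

lemma claw_free_card_le:
  assumes "claw_free G (k + 1)" "c \<in> verts G" "independent G T" "\<And>t. t \<in> T \<Longrightarrow> c \<rightarrow>\<^bsub>G\<^esub> t"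
  shows "card T \<le> k"
proof (rule ccontr)
  assume "\<not> card T \<le> k"
  then obtain T' where "T' \<subseteq> T" "card T' = k + 1"
    by (metis Suc_eq_plus1 not_less_eq_eq obtain_subset_with_card_n)
  then have "is_claw G (k + 1) c T'"
    using assms(2-4) unfolding is_claw_def independent_def by blast
  with assms(1) show False unfolding claw_free_def by blast
qed

context
  fixes G :: "('a, 'b) pre_digraph" and w :: "'a \<Rightarrow> real"
  assumes G: "graph G"
begin

lemma adj_sym: "u \<rightarrow>\<^bsub>G\<^esub> v \<longleftrightarrow> v \<rightarrow>\<^bsub>G\<^esub> u"
proof -
  interpret graph G by (rule G)
  show ?thesis using arcs_ends_symmetric[OF sym_arcs] by blast
qed

lemma adj_irrefl: "\<not> v \<rightarrow>\<^bsub>G\<^esub> v"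
proof -
  interpret graph G by (rule G)
  show ?thesis using adj_not_same by auto
qed

lemma greedy_step_independent:
  "greedy_step G w S T \<Longrightarrow> independent G S \<Longrightarrow> independent G T"
  by (induction rule: greedy_step.induct)
    (use adj_sym adj_irrefl in \<open>auto simp: independent_def greedy_candidates_def\<close>)

lemma exchange_step_independent:
  "exchange_step s k G w S T \<Longrightarrow> independent G S \<Longrightarrow> independent G T"
proof (induction rule: exchange_step.induct)
  case (1 C S)
  have "\<not> u \<rightarrow>\<^bsub>G\<^esub> v" "\<not> v \<rightarrow>\<^bsub>G\<^esub> u" if "u \<in> C" "v \<in> S - nbhd G C S" for u v
    using that adj_sym unfolding nbhd_def by auto
  with 1 show ?case unfolding independent_def by blast
qed

lemma local_search_returns_independent:
  assumes "local_search_returns s k G w S"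
  shows "independent G S"
proof -
  obtain S\<^sub>0 where S\<^sub>0: "(greedy_step G w)\<^sup>*\<^sup>* {} S\<^sub>0" "(exchange_step s k G w)\<^sup>*\<^sup>* S\<^sub>0 S"
    using assms unfolding local_search_returns_def runs_to_def by auto
  from S\<^sub>0(1) have "independent G S\<^sub>0"
    by (induction rule: rtranclp_induct)
      (auto simp: independent_def[of G "{}"] intro: greedy_step_independent)
  with S\<^sub>0(2) show ?thesis
    by (induction rule: rtranclp_induct) (auto intro: exchange_step_independent)
qed

text \<open>The search only exchanges sets disjoint from \<open>S\<close>, so its optimality is
  applied to \<open>C - S\<close>. Elements of \<open>C \<inter> S\<close> are their own neighbours
  and are added on both sides.\<close>

lemma local_search_exchange_optimum:
  assumes k: "k \<ge> 1" and s: "s \<ge> 1" and claw: "claw_free G (k + 1)"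
    and pos: "\<forall>v\<in>verts G. w v > 0" and Q: "independent G Q"
    and ret: "local_search_returns s k G w S"
  shows "exchange_optimum S Q w (\<lambda>q. nbhd G {q} S) k s"
proof -
  have S: "independent G S" by (rule local_search_returns_independent[OF ret])
  have V: "S \<subseteq> verts G" "Q \<subseteq> verts G" using S Q unfolding independent_def by auto
  have fin: "finite S" "finite Q" using V finite_vertices[OF G] finite_subset by auto
  have opt: "sq_weight w C \<le> sq_weight w (\<Union>((\<lambda>q. nbhd G {q} S) ` C))"
    if C: "C \<subseteq> Q" "card C \<le> s * k" for C
  proof -
    have finC: "finite C" using finite_subset[OF C(1) fin(2)] .
    have "\<nexists>T. exchange_step s k G w S T"
      using ret unfolding local_search_returns_def runs_to_def by auto
    moreover have "C - S \<subseteq> verts G - S" using C(1) V by auto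
    moreover have "independent G (C - S)" using C(1) Q unfolding independent_def by blast
    moreover have "card (C - S) \<le> s * k" using C(2) card_mono[OF finC, of "C - S"] by auto
    ultimately have le: "sq_weight w (C - S) \<le> sq_weight w (nbhd G (C - S) S)"
      using exchange_step.intros[of "C - S" G S s k w] by force
    \<comment> \<open>No element of \<open>C \<inter> S\<close> is adjacent to \<open>C - S\<close>,
      because \<open>Q\<close> is independent.\<close>
    have disj: "nbhd G (C - S) S \<inter> (C \<inter> S) = {}"
      using C(1) Q unfolding nbhd_def independent_def by blast
    have "sq_weight w C = sq_weight w (C - S) + sq_weight w (C \<inter> S)"
      unfolding sq_weight_def using finC
      by (subst sum.union_disjoint[symmetric]) (auto intro: sum.cong)
    also have "\<dots> \<le> sq_weight w (nbhd G (C - S) S) + sq_weight w (C \<inter> S)" using le by simp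
    also have "\<dots> = sq_weight w (nbhd G (C - S) S \<union> (C \<inter> S))"
      unfolding sq_weight_def using fin(1) finC disj
      by (intro sum.union_disjoint[symmetric]) (auto simp: nbhd_def)
    also have "\<dots> \<le> sq_weight w (\<Union>((\<lambda>q. nbhd G {q} S) ` C))"
      unfolding sq_weight_def using fin(1) finC
      by (intro sum_mono2) (auto simp: nbhd_def)
    finally show ?thesis .
  qed
  show ?thesis
  proof
    show "finite S" "finite Q" by (rule fin)+
    show "0 < w v" if "v \<in> S \<union> Q" for v using that V pos by auto
    show "nbhd G {q} S \<subseteq> S" for q unfolding nbhd_def by auto
    show "nbhd G {q} S \<noteq> {}" if q: "q \<in> Q" for q
    proof
      assume "nbhd G {q} S = {}"
      \<comment> \<open>A vertex without neighbours in \<open>S\<close> would be an improving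
        exchange on its own.\<close>
      moreover have "card {q} \<le> s * k" using k s mult_le_mono[of 1 s 1 k] by simp
      ultimately have "sq_weight w {q} \<le> 0" using opt[of "{q}"] q by (simp add: sq_weight_def)
      moreover have "0 < w q" using q V pos by auto
      ultimately show False by (simp add: sq_weight_def)
    qed
    show "card (nbhd G {q} S) \<le> k" if q: "q \<in> Q" for q
    proof (cases "q \<in> S")
      case True
      then have "nbhd G {q} S = {q}" using S unfolding nbhd_def independent_def by auto
      with k show ?thesis by simp
    next
      case False
      have "independent G (nbhd G {q} S)" using S unfolding independent_def nbhd_def by auto
      moreover have "q \<rightarrow>\<^bsub>G\<^esub> t" if "t \<in> nbhd G {q} S" for t
        using that False unfolding nbhd_def by auto
      ultimately show ?thesis using claw_free_card_le[OF claw, of q] q V by auto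
    qed
    show "card {q \<in> Q. a \<in> nbhd G {q} S} \<le> k" if a: "a \<in> S" for a
    proof (cases "a \<in> Q")
      case True
      then have "{q \<in> Q. a \<in> nbhd G {q} S} \<subseteq> {a}" using Q unfolding nbhd_def independent_def by auto
      then have "card {q \<in> Q. a \<in> nbhd G {q} S} \<le> card {a}" by (intro card_mono) auto
      with k show ?thesis by simp
    next
      \<comment> \<open>For \<open>a\<close> outside \<open>Q\<close> the counted \<open>q\<close>
        are talons of a claw centred at \<open>a\<close>.\<close>
      case False
      have "a \<in> verts G" using a V by auto
      moreover have "independent G {q \<in> Q. a \<in> nbhd G {q} S}"
        using Q unfolding independent_def by auto
      moreover have "a \<rightarrow>\<^bsub>G\<^esub> t" if "t \<in> {q \<in> Q. a \<in> nbhd G {q} S}" for t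
        using that False adj_sym unfolding nbhd_def by auto
      ultimately show ?thesis by (rule claw_free_card_le[OF claw])
    qed
  qed (rule opt)
qed

end

theorem theorem1:
  fixes G :: "('a, 'b) pre_digraph" and w :: "'a \<Rightarrow> real" and k :: nat and Opt :: "'a set"
  assumes "k \<ge> 1"
    and "graph G"
    and "claw_free G (k + 1)"
    and "\<forall>v\<in>verts G. w v > 0"
    and "max_weight_independent G w Opt"
  shows
    "((\<forall>S. local_search_returns (k * (k - 1) + 1) k G w S \<longrightarrow>
          weight w Opt \<le> (real k + 1 - tau1 k) / 2 * weight w S)
      \<and> mono_on {1..} tau1 \<and> tau1 \<longlonglongrightarrow> 1 / 2)
     \<and>
     ((\<forall>S. local_search_returns (2 * k * (k - 1) + 1) k G w S \<longrightarrow>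
          weight w Opt \<le> (real k + 1 - tau2 k) / 2 * weight w S)
      \<and> mono_on {1..} tau2 \<and> tau2 \<longlonglongrightarrow> 2 / 3)"
proof -
  have Opt: "independent G Opt" using assms(5) unfolding max_weight_independent_def by simp
  note optimum = local_search_exchange_optimum[OF assms(2,1) _ assms(3,4) Opt]
  have 1: "weight w Opt \<le> (real k + 1 - tau1 k) / 2 * weight w S"
    if ret: "local_search_returns (k * (k - 1) + 1) k G w S" for S
  proof -
    \<comment> \<open>The discount is read off from a point where the maximum is attained.\<close>
    obtain e where e: "e \<in> {0..1/2}" "tau1 k = tau1_objective k e" using tau1_attained by blast
    note r = sqrt_discount[OF e(1)]
    interpret exchange_optimum S Opt w "\<lambda>q. nbhd G {q} S" k "k * (k - 1) + 1"
      by (rule optimum[OF _ ret]) simp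
    interpret exchange_optimum_scale S Opt w "\<lambda>q. nbhd G {q} S" k "k * (k - 1) + 1" "sqrt (1 - e)"
      by unfold_locales (rule r)+
    have "2 * weight w Opt \<le> (real k + 1 - tau1 k) * weight w S"
      by (rule weight_bound_short) (simp_all add: e(2) tau1_objective_def r(3))
    then show ?thesis by simp
  qed
  have 2: "weight w Opt \<le> (real k + 1 - tau2 k) / 2 * weight w S"
    if ret: "local_search_returns (2 * k * (k - 1) + 1) k G w S" for S
  proof -
    obtain e where e: "e \<in> {0..1/2}" "tau2 k = tau2_objective k e" using tau2_attained by blast
    note r = sqrt_discount[OF e(1)]
    interpret exchange_optimum S Opt w "\<lambda>q. nbhd G {q} S" k "2 * k * (k - 1) + 1"
      by (rule optimum[OF _ ret]) simp
    interpret exchange_optimum_scale S Opt w "\<lambda>q. nbhd G {q} S" k "2 * k * (k - 1) + 1" "sqrt (1 - e)"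
      by unfold_locales (rule r)+
    have "2 * weight w Opt \<le> (real k + 1 - tau2 k) * weight w S"
      by (rule weight_bound_long) (simp_all add: e(2) tau2_objective_def r(3) mult.assoc)
    then show ?thesis by simp
  qed
  show ?thesis using 1 2 mono_on_tau1 mono_on_tau2 tau1_limit tau2_limit by blast
qed

end
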